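(* Let $m,n,s\in\mathbb{Z}$ with $0\le m,n\le s$, and let $\lambda,\gamma,\delta\in\mathbb{C}$ with $\lambda-\gamma,\ \lambda-\delta,\ \lambda-\delta-\gamma\notin\mathbb{Z}_{\ge0}$. Then the matrix elements $R_{q,\gamma,\delta,s;m,n}(\lambda)$ of the exchange matrix can be expressed in terms of $q$-Racah polynomials as follows: $$R_{q,\gamma,\delta,s;m,n}(\lambda)=q^{\frac\gamma4(\delta-2s)}\,q^{\frac n4(2n+\delta+\gamma-2s)}\,q^{\frac m4(-3\delta+\gamma+6s-2m)}\,\frac{(q^{-\gamma};q)_n}{(q^{\lambda-\gamma+n+1};q)_n}\,\frac{(q^{-s},q^{\delta-s+1};q)_m}{(q,q^{\delta-\lambda-2s+m-1};q)_m}$$ $$\times\;R_m(\mu(n),q^{\delta-s},q^{-\lambda-s-2},q^{-s-1},q^{\lambda-\gamma+s+1}),$$ where $\mu(n):=q^{-n}+q^{\lambda-\gamma+n+1}$ and the $q$-Racah polynomials are given by $$R_m(\mu(n),q^{\delta-s},q^{-\lambda-s-2},q^{-s-1},q^{\lambda-\gamma+s+1}):={}_4\phi_3\!\left(\begin{matrix} q^{-n},\,q^{-m},\,q^{\lambda-\gamma+n+1},\,q^{-\lambda+\delta-2s+m-1} \\ {q^{-s}},\,q^{-\gamma},\,q^{\delta-s+1} \end{matrix};q,q\right).$$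
   Context: Fix $0<q<1$, $q^z:=\exp(z\ln q)$. Notation: $[a]_q:=\frac{q^{a/2}-q^{-a/2}}{q^{1/2}-q^{-1/2}}$, $[k]_q!:=\prod_{i=1}^k[i]_q$, $([a]_q)_k:=\prod_{i=0}^{k-1}[a+i]_q$, $(a;q)_k:=\prod_{i=0}^{k-1}(1-aq^i)$, $(a_1,\dots,a_r;q)_k:=\prod_i(a_i;q)_k$, ${}_4\phi_3\left(\begin{matrix} a_1,\dots,a_4 \\ {b_1},b_2,b_3 \end{matrix};q,z\right):=\sum_{k\ge0}\frac{(a_1,\dots,a_4;q)_k}{(b_1,b_2,b_3,q;q)_k}z^k$, a sum terminating at the smallest $r\in\mathbb{Z}_{\ge0}$ for which some $a_i=q^{-r}$ (if any); the $b_j$ are not allowed to equal $q^{-p}$ with $p\in\mathbb{Z}_{\ge0}$ unless some $a_i=q^{-r}$ with $r\in\mathbb{Z}_{\ge0}$, $r\le p$. The Verma module $M_{q,\lambda}$ of $\mathcal U_q(sl(2,\mathbb{C}))$ has basis $x^\lambda_{\lambda-2k}$ ($k\in\mathbb{Z}_{\ge0}$), with $hx^\lambda_{\lambda-2k}=(\lambda-2k)x^\lambda_{\lambda-2k}$, $fx^\lambda_{\lambda-2k}=x^\lambda_{\lambda-2k-2}$, $ex^\lambda_{\lambda-2k}=[k]_q[\lambda-k+1]_qx^\lambda_{\lambda-2k+2}$ (zero for $k=0$). A weight vector $v$ of weight $\nu=\mathrm{wt}(v)$ is a nonzero vector with $hv=\nu v$. Functions of $h$ act on it by substituting $\nu$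 for $h$; $q^{\frac14 h\otimes h}$ acts on $u\otimes v$ of weights $\alpha,\beta$ as $q^{\alpha\beta/4}$; products act right to left. Fusion matrix: for Verma modules $W,V$, $J_{W,V}(\lambda)$ is the operator on $W\otimes V$ given, for weight vectors $w\in W$, $v\in V$ with $\lambda-\mathrm{wt}(v),\ \lambda-\mathrm{wt}(v)-\mathrm{wt}(w)\notin\mathbb{Z}_{\ge0}$, by $$J_{W,V}(\lambda)(w\otimes v)=\sum_{l\ge0}\frac{q^{-\frac l2(\lambda+1)}}{[l]_q!}f^lq^{lh/4}\cdot w\otimes e^l\frac{q^{lh/4}}{([-\lambda+h]_q)_l}\cdot v;$$ it is invertible. $\mathcal R$-matrix: $$\mathcal R=q^{\frac14(h\otimes h)}\sum_{j\ge0}\frac{(1-q^{-1})^jq^{-\frac14j(j-1)}}{[j]_q!}\,\bigl(q^{\frac14jh}e^j\otimes q^{-\frac14jh}f^j\bigr).$$ Exchange matrix: with $P$ the flip $u\otimes v\mapsto v\otimes u$, $R_{V,W}(\lambda):=J_{V,W}^{-1}(\lambda)\,(P\mathcal RP)\,(PJ_{W,V}(\lambda)P)$ on $V\otimes W$. For $V=M_{q,\gamma}$, $W=M_{q,\delta}$ write $R_{q,\gamma,\delta}(\lambda)$, with matrix elements defined by $$R_{q,\gamma,\delta}(\lambda)(x^\gamma_{\gamma-2n}\otimes x^\delta_{\delta-2s+2n})=\sum_{m=0}^sR_{q,\gamma,\delta,s;m,n}(\lambda)\,x^\gamma_{\gamma-2m}\otimes x^\delta_{\delta-2s+2m}.$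$
   Formalization: The formal theorem also assumes that the denominators ([-λ+h]_q)_l occurring in the two fusion matrices do not vanish and that the lower parameters of the 4φ3 are allowed by its convention; the three stated conditions on λ, γ, δ do not ensure this (e.g. λ-γ=-2, n=1). *)

theory Defs
  imports "HOL-Analysis.Analysis" "HOL-Library.Poly_Mapping"
begin

section \<open>\<open>q\<close>-numbers and basic hypergeometric series\<close>

definition qpow :: "real \<Rightarrow> complex \<Rightarrow> complex" where
  "qpow q z = exp (z * of_real (ln q))"

definition qnum :: "real \<Rightarrow> complex \<Rightarrow> complex" where
  "qnum q a = (qpow q (a/2) - qpow q (-a/2)) / (qpow q (1/2) - qpow q (-1/2))"

definition qfact :: "real \<Rightarrow> nat \<Rightarrow> complex" where
  "qfact q k = (\<Prod>i=1..k. qnum q (of_nat i))"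

definition qrising :: "real \<Rightarrow> complex \<Rightarrow> nat \<Rightarrow> complex" where
  "qrising q a k = (\<Prod>i<k. qnum q (a + of_nat i))"

definition qpoch :: "complex \<Rightarrow> real \<Rightarrow> nat \<Rightarrow> complex" where
  "qpoch a q k = (\<Prod>i<k. 1 - a * of_real q ^ i)"

definition qpochs :: "complex list \<Rightarrow> real \<Rightarrow> nat \<Rightarrow> complex" where
  "qpochs as q k = (\<Prod>a\<leftarrow>as. qpoch a q k)"

definition qhyp_term :: "complex list \<Rightarrow> complex list \<Rightarrow> real \<Rightarrow> complex \<Rightarrow> nat \<Rightarrow> complex" where
  "qhyp_term as bs q z k = qpochs as q k / qpochs (bs @ [of_real q]) q k * z ^ k"

text \<open>The series is meant for one more upper than lower parameter (so with four upper and three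
  lower ones it is the \<open>4\<phi>3\<close> series). A terminating series is cut off explicitly: past the
  cut-off the terms may be of the form \<open>0/0\<close>.\<close>

definition qhyp_stops :: "complex list \<Rightarrow> real \<Rightarrow> nat \<Rightarrow> bool" where
  "qhyp_stops as q r \<longleftrightarrow> (\<exists>a\<in>set as. a = qpow q (- of_nat r))"

definition qhyp :: "complex list \<Rightarrow> complex list \<Rightarrow> real \<Rightarrow> complex \<Rightarrow> complex" where
  "qhyp as bs q z =
     (if \<exists>r. qhyp_stops as q r
      then \<Sum>k\<le>(LEAST r. qhyp_stops as q r). qhyp_term as bs q z k
      else suminf (qhyp_term as bs q z))"

definition qhyp_allowed :: "complex list \<Rightarrow> complex list \<Rightarrow> real \<Rightarrow> bool" where
  "qhyp_allowed as bs q \<longleftrightarrow>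
     (\<forall>b\<in>set bs. \<forall>p. b = qpow q (- of_nat p) \<longrightarrow> (\<exists>r\<le>p. qhyp_stops as q r))"

text \<open>The \<open>q\<close>-Racah polynomial \<open>R\<^sub>m(\<mu>(n), \<alpha>, \<beta>, c, d)\<close>, given by its values at the
  points \<open>\<mu>(n) = q^(-n) + c d q^(n+1)\<close>.\<close>

definition q_racah ::
    "real \<Rightarrow> nat \<Rightarrow> nat \<Rightarrow> complex \<Rightarrow> complex \<Rightarrow> complex \<Rightarrow> complex \<Rightarrow> complex" where
  "q_racah q m n \<alpha> \<beta> c d =
     qhyp [qpow q (- of_nat n), qpow q (- of_nat m),
           c * d * of_real q ^ (n + 1), \<alpha> * \<beta> * of_real q ^ (m + 1)]
          [c * of_real q, \<beta> * d * of_real q, \<alpha> * of_real q] q (of_real q)"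

section \<open>Verma modules and their tensor products\<close>

text \<open>The Verma module with highest weight \<open>\<mu>\<close> is the free vector space on \<open>nat\<close>; the basis
  vector with index \<open>k\<close> is \<open>x\<^sup>\<mu>\<close> of weight \<open>\<mu> - 2k\<close>. The highest weight enters only through
  the action. The tensor product of two Verma modules is the free vector space on
  \<open>nat \<times> nat\<close>.\<close>

type_synonym verma = "nat \<Rightarrow>\<^sub>0 complex"
type_synonym verma2 = "nat \<times> nat \<Rightarrow>\<^sub>0 complex"

definition scal :: "complex \<Rightarrow> ('a \<Rightarrow>\<^sub>0 complex) \<Rightarrow> ('a \<Rightarrow>\<^sub>0 complex)" where
  "scal c v = Poly_Mapping.map (\<lambda>x. c * x) v"

abbreviation bas :: "'a \<Rightarrow> ('a \<Rightarrow>\<^sub>0 complex)" where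
  "bas k \<equiv> Poly_Mapping.single k 1"

text \<open>Linear extension of a map given on the basis.\<close>

definition lin_ext :: "('a \<Rightarrow> ('b \<Rightarrow>\<^sub>0 complex)) \<Rightarrow> ('a \<Rightarrow>\<^sub>0 complex) \<Rightarrow> ('b \<Rightarrow>\<^sub>0 complex)" where
  "lin_ext T v = (\<Sum>k\<in>Poly_Mapping.keys v. scal (Poly_Mapping.lookup v k) (T k))"

definition wt :: "complex \<Rightarrow> nat \<Rightarrow> complex" where
  "wt \<mu> k = \<mu> - 2 * of_nat k"

definition f_act :: "verma \<Rightarrow> verma" where
  "f_act = lin_ext (\<lambda>k. bas (Suc k))"

definition e_act :: "real \<Rightarrow> complex \<Rightarrow> verma \<Rightarrow> verma" where
  "e_act q \<mu> = lin_ext (\<lambda>k. if k = 0 then 0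
     else scal (qnum q (of_nat k) * qnum q (\<mu> - of_nat k + 1)) (bas (k - 1)))"

text \<open>Action of the function \<open>\<phi>(h)\<close> of \<open>h\<close>.\<close>

definition h_act :: "complex \<Rightarrow> (complex \<Rightarrow> complex) \<Rightarrow> verma \<Rightarrow> verma" where
  "h_act \<mu> \<phi> = lin_ext (\<lambda>k. scal (\<phi> (wt \<mu> k)) (bas k))"

definition tens :: "verma \<Rightarrow> verma \<Rightarrow> verma2" where
  "tens v w = (\<Sum>i\<in>Poly_Mapping.keys v. \<Sum>j\<in>Poly_Mapping.keys w.
     Poly_Mapping.single (i, j) (Poly_Mapping.lookup v i * Poly_Mapping.lookup w j))"

definition tens_op :: "(verma \<Rightarrow> verma) \<Rightarrow> (verma \<Rightarrow> verma) \<Rightarrow> verma2 \<Rightarrow> verma2" where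
  "tens_op A B = lin_ext (\<lambda>(i, j). tens (A (bas i)) (B (bas j)))"

definition flip :: "verma2 \<Rightarrow> verma2" where
  "flip = lin_ext (\<lambda>(i, j). bas (j, i))"

definition q_hh :: "real \<Rightarrow> complex \<Rightarrow> complex \<Rightarrow> verma2 \<Rightarrow> verma2" where
  "q_hh q \<mu> \<nu> = lin_ext (\<lambda>(i, j). scal (qpow q (wt \<mu> i * wt \<nu> j / 4)) (bas (i, j)))"

section \<open>Fusion matrix, universal R-matrix and exchange matrix\<close>

text \<open>The operators below act on the tensor product of the Verma modules with highest weights
  \<open>\<mu>\<close> and \<open>\<nu>\<close>, in this order. The sums over \<open>l\<close> and \<open>j\<close> are sums over all natural numbers;
  on each vector only finitely many terms are nonzero, since \<open>e\<close> is locally nilpotent, so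
  \<^const>\<open>Sum_any\<close> is the sum meant.\<close>

definition fusion :: "real \<Rightarrow> complex \<Rightarrow> complex \<Rightarrow> complex \<Rightarrow> verma2 \<Rightarrow> verma2" where
  "fusion q lam \<mu> \<nu> v = Sum_any (\<lambda>l::nat.
     scal (qpow q (- (of_nat l / 2) * (lam + 1)) / qfact q l)
       (tens_op
          ((f_act ^^ l) \<circ> h_act \<mu> (\<lambda>h. qpow q (of_nat l * h / 4)))
          ((e_act q \<nu> ^^ l) \<circ> h_act \<nu> (\<lambda>h. qpow q (of_nat l * h / 4) / qrising q (- lam + h) l))
          v))"

text \<open>The denominators of the fusion matrix on \<open>w \<otimes> v\<close> do not vanish, where \<open>v\<close> is the basis
  vector with index \<open>k\<close> of the Verma module with highest weight \<open>\<nu>\<close>. The terms with \<open>l > k\<close>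
  are absent, because \<open>e^l v = 0\<close>.\<close>

definition fusion_defined :: "real \<Rightarrow> complex \<Rightarrow> complex \<Rightarrow> nat \<Rightarrow> bool" where
  "fusion_defined q lam \<nu> k \<longleftrightarrow> (\<forall>l\<le>k. qrising q (- lam + wt \<nu> k) l \<noteq> 0)"

definition R_matrix :: "real \<Rightarrow> complex \<Rightarrow> complex \<Rightarrow> verma2 \<Rightarrow> verma2" where
  "R_matrix q \<mu> \<nu> v = q_hh q \<mu> \<nu> (Sum_any (\<lambda>j::nat.
     scal ((1 - inverse (of_real q)) ^ j * qpow q (- (of_nat j * (of_nat j - 1)) / 4) / qfact q j)
       (tens_op
          (h_act \<mu> (\<lambda>h. qpow q (of_nat j * h / 4)) \<circ> (e_act q \<mu> ^^ j))
          (h_act \<nu> (\<lambda>h. qpow q (- (of_nat j * h) / 4)) \<circ> (f_act ^^ j))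
          v)))"

text \<open>The exchange matrix on \<open>V \<otimes> W\<close>, with \<open>V\<close>, \<open>W\<close> the Verma modules of highest weight
  \<open>\<gamma>\<close>, \<open>\<delta>\<close>. The fusion matrix preserves the finite-dimensional weight spaces and is
  unitriangular on each of them, hence it is a bijection and \<^const>\<open>inv\<close> is its inverse.\<close>

definition exchange :: "real \<Rightarrow> complex \<Rightarrow> complex \<Rightarrow> complex \<Rightarrow> verma2 \<Rightarrow> verma2" where
  "exchange q \<gamma> \<delta> lam =
     inv (fusion q lam \<gamma> \<delta>) \<circ> (flip \<circ> R_matrix q \<delta> \<gamma> \<circ> flip) \<circ> (flip \<circ> fusion q lam \<delta> \<gamma> \<circ> flip)"

text \<open>The coefficient of the basis vector with indices \<open>(m, s - m)\<close> in the image of the basis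
  vector with indices \<open>(n, s - n)\<close>; it is meant for \<open>m, n \<le> s\<close>.\<close>

definition exchange_elem ::
    "real \<Rightarrow> complex \<Rightarrow> complex \<Rightarrow> nat \<Rightarrow> nat \<Rightarrow> nat \<Rightarrow> complex \<Rightarrow> complex" where
  "exchange_elem q \<gamma> \<delta> s m n lam =
     Poly_Mapping.lookup (exchange q \<gamma> \<delta> lam (tens (bas n) (bas (s - n)))) (m, s - m)"

end

theory Submission
  imports Defs
begin

text \<open>
  On the weight space spanned by the \<open>x\<^sub>k \<otimes> x\<^bsub>s-k\<^esub>\<close>, the operator \<open>P J\<^bsub>W,V\<^esub> P\<close> is upper
  triangular, whereas \<open>J\<^bsub>V,W\<^esub>\<close> and \<open>P \<R> P\<close> are lower triangular. Hence the matrix elements of the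
  exchange matrix are sums \<open>\<Sum>\<^sub>k L m k * U k n\<close> over \<open>k \<le> min m n\<close>, and these are term by term the
  terminating \<open>4\<phi>3\<close> series. The factor \<open>L = J\<^bsub>V,W\<^esub>\<^sup>-\<^sup>1 (P \<R> P)\<close> has a product form: its entry at
  \<open>(m, k)\<close> is that of \<open>P \<R> P\<close> divided by \<open>(q^(\<delta>-\<lambda>-2s+m+k-1); q)\<^bsub>m-k\<^esub>\<close>. Checking \<open>J L = P \<R> P\<close>
  amounts to a terminating very-well-poised summation (a limit of the \<open>6\<phi>5\<close> sum), which is
  proved by telescoping.
\<close>

section \<open>Linear extensions and the operators on basis vectors\<close>

lemma lookup_scal [simp]: "Poly_Mapping.lookup (scal c v) k = c * Poly_Mapping.lookup v k"
  unfolding scal_def by (simp add: Poly_Mapping.map.rep_eq when_def)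

lemma scal_0_left [simp]: "scal 0 v = 0"
  by (rule poly_mapping_eqI) simp

lemma scal_0_right [simp]: "scal c 0 = 0"
  by (rule poly_mapping_eqI) simp

lemma scal_1 [simp]: "scal 1 v = v"
  by (rule poly_mapping_eqI) simp

lemma scal_scal [simp]: "scal a (scal b v) = scal (a * b) v"
  by (rule poly_mapping_eqI) (simp add: mult.assoc)

lemma scal_add_left: "scal (a + b) v = scal a v + scal b v"
  by (rule poly_mapping_eqI) (simp add: lookup_add algebra_simps)

lemma scal_add_right: "scal a (v + w) = scal a v + scal a w"
  by (rule poly_mapping_eqI) (simp add: lookup_add algebra_simps)

lemma scal_sum_left: "scal (\<Sum>i\<in>I. c i) v = (\<Sum>i\<in>I. scal (c i) v)"
  by (induction I rule: infinite_finite_induct) (simp_all add: scal_add_left)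

lemma scal_sum_right: "scal c (\<Sum>i\<in>I. v i) = (\<Sum>i\<in>I. scal c (v i))"
  by (induction I rule: infinite_finite_induct) (simp_all add: scal_add_right)

lemma scal_bas: "scal c (bas k) = Poly_Mapping.single k c"
  by (rule poly_mapping_eqI) (simp add: lookup_single when_def)

text \<open>The support of a vector can shrink under scaling or addition; summing over a common
  finite superset makes linearity a termwise statement.\<close>

lemma lin_ext_superset:
  assumes "finite S" "Poly_Mapping.keys v \<subseteq> S"
  shows "lin_ext T v = (\<Sum>k\<in>S. scal (Poly_Mapping.lookup v k) (T k))"
  unfolding lin_ext_def using assms
  by (intro sum.mono_neutral_left) (auto simp: in_keys_iff)

lemma lin_ext_bas [simp]: "lin_ext T (bas k) = T k"
  by (subst lin_ext_superset[of "{k}"]) auto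

lemma lin_ext_0 [simp]: "lin_ext T 0 = 0"
  by (simp add: lin_ext_def)

lemma lin_ext_scal: "lin_ext T (scal c v) = scal c (lin_ext T v)"
  by (subst (1 2) lin_ext_superset[of "Poly_Mapping.keys v"])
     (auto simp: in_keys_iff scal_sum_right)

lemma lin_ext_add: "lin_ext T (v + w) = lin_ext T v + lin_ext T w"
  using Poly_Mapping.keys_add[of v w]
  by (subst (1 2 3) lin_ext_superset[of "Poly_Mapping.keys v \<union> Poly_Mapping.keys w"])
     (auto simp: lookup_add scal_add_left sum.distrib)

lemma lin_ext_sum: "lin_ext T (\<Sum>i\<in>I. v i) = (\<Sum>i\<in>I. lin_ext T (v i))"
  by (induction I rule: infinite_finite_induct) (simp_all add: lin_ext_add)

lemma tens_scal_bas: "tens (scal a (bas i)) (scal b (bas j)) = scal (a * b) (bas (i, j))"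
proof (cases "a = 0 \<or> b = 0")
  case True
  then show ?thesis by (auto simp: tens_def)
next
  case False
  then show ?thesis by (simp add: tens_def scal_bas)
qed

lemma tens_bas: "tens (bas i) (bas j) = bas (i, j)"
  using tens_scal_bas[of 1 i 1 j] by simp

text \<open>Turns the operator sums over all \<open>l\<close> in \<open>fusion\<close> and
  \<open>R_matrix\<close> into one linear extension whose cut-off \<open>B k\<close> depends on the
  basis vector. A vector has finite support, so a single cut-off serves all its basis vectors and
  the two sums can be swapped.\<close>

lemma Sum_any_scal_lin_ext:
  assumes "\<And>l k. B k < l \<Longrightarrow> T l k = 0"
  shows "Sum_any (\<lambda>l::nat. scal (c l) (lin_ext (T l) v)) =
    lin_ext (\<lambda>k. \<Sum>l\<le>B k. scal (c l) (T l k)) v"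
proof -
  let ?K = "Poly_Mapping.keys v"
  \<comment> \<open>Only a common bound for the cut-offs on the support is wanted; a sum of naturals
    dominates each summand.\<close>
  define M where "M = (\<Sum>k\<in>?K. B k)"
  have M: "B k \<le> M" if "k \<in> ?K" for k
    unfolding M_def using that by (intro member_le_sum) auto
  have zero: "lin_ext (T l) v = 0" if "M < l" for l
    unfolding lin_ext_def using M that assms
    by (intro sum.neutral ballI) (metis le_less_trans scal_0_right)
  have "Sum_any (\<lambda>l. scal (c l) (lin_ext (T l) v)) = (\<Sum>l\<le>M. scal (c l) (lin_ext (T l) v))"
    using zero by (intro Sum_any.expand_superset) (auto simp: not_less[symmetric])
  also have "\<dots> = (\<Sum>k\<in>?K. scal (Poly_Mapping.lookup v k) (\<Sum>l\<le>M. scal (c l) (T l k)))"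
    unfolding lin_ext_def scal_sum_right scal_scal
    by (subst sum.swap) (simp only: mult.commute)
  also have "\<dots> = (\<Sum>k\<in>?K. scal (Poly_Mapping.lookup v k) (\<Sum>l\<le>B k. scal (c l) (T l k)))"
  proof (rule sum.cong[OF refl])
    fix k assume "k \<in> ?K"
    then have "(\<Sum>l\<le>B k. scal (c l) (T l k)) = (\<Sum>l\<le>M. scal (c l) (T l k))"
      using M[of k] assms by (intro sum.mono_neutral_left) auto
    then show "scal (Poly_Mapping.lookup v k) (\<Sum>l\<le>M. scal (c l) (T l k)) =
      scal (Poly_Mapping.lookup v k) (\<Sum>l\<le>B k. scal (c l) (T l k))" by simp
  qed
  finally show ?thesis by (simp add: lin_ext_def)
qed

section \<open>Powers of e and f on basis vectors\<close>

definition e_coeff :: "real \<Rightarrow> complex \<Rightarrow> nat \<Rightarrow> nat \<Rightarrow> complex" where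
  "e_coeff q \<mu> k l = (\<Prod>u<l. qnum q (of_nat k - of_nat u) * qnum q (\<mu> - of_nat k + of_nat u + 1))"

lemma qnum_0 [simp]: "qnum q 0 = 0"
  by (simp add: qnum_def)

text \<open>The difference \<open>of_nat k - of_nat u\<close> is complex and not truncated, so the
  factor \<open>u = k\<close> is \<open>qnum q 0\<close>.\<close>

lemma e_coeff_eq_0: "k < l \<Longrightarrow> e_coeff q \<mu> k l = 0"
  by (auto simp: e_coeff_def intro!: bexI[of _ k])

text \<open>The composition rule e^(l + l') = e^l' e^l, read off on a basis vector.\<close>

lemma e_coeff_mult:
  "l \<le> k \<Longrightarrow> e_coeff q \<mu> k l * e_coeff q \<mu> (k - l) l' = e_coeff q \<mu> k (l + l')"
proof (induction l')
  case 0
  then show ?case by (simp add: e_coeff_def)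
next
  case (Suc l')
  then show ?case
    by (simp add: e_coeff_def of_nat_diff algebra_simps)
qed

lemma f_act_pow_bas: "(f_act ^^ l) (bas k) = bas (k + l)"
  by (induction l) (simp_all add: f_act_def)

lemma f_act_pow_scal: "(f_act ^^ l) (scal c v) = scal c ((f_act ^^ l) v)"
  by (induction l) (simp_all add: f_act_def lin_ext_scal)

lemma e_act_pow_bas: "(e_act q \<mu> ^^ l) (bas k) = scal (e_coeff q \<mu> k l) (bas (k - l))"
proof (induction l)
  case 0
  then show ?case by (simp add: e_coeff_def)
next
  case (Suc l)
  show ?case
  proof (cases "l < k")
    case True
    then show ?thesis using Suc
      by (simp add: e_act_def lin_ext_scal e_coeff_def of_nat_diff algebra_simps)
  next
    \<comment> \<open>Here \<open>k - l\<close> is truncated to 0, so one more \<open>e_act\<close>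
      kills the vector, in agreement with the vanishing coefficient.\<close>
    case False
    then have "e_coeff q \<mu> k (Suc l) = 0" by (intro e_coeff_eq_0) simp
    with False Suc show ?thesis
      by (simp add: e_act_def lin_ext_scal del: single_one)
  qed
qed

lemma e_act_pow_scal: "(e_act q \<mu> ^^ l) (scal c v) = scal c ((e_act q \<mu> ^^ l) v)"
  by (induction l) (simp_all add: e_act_def lin_ext_scal)

lemma h_act_bas: "h_act \<mu> \<phi> (bas k) = scal (\<phi> (wt \<mu> k)) (bas k)"
  by (simp add: h_act_def)

lemma h_act_scal: "h_act \<mu> \<phi> (scal c v) = scal c (h_act \<mu> \<phi> v)"
  by (simp add: h_act_def lin_ext_scal)

lemmas act_simps = f_act_pow_bas f_act_pow_scal e_act_pow_bas e_act_pow_scal h_act_bas h_act_scal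

section \<open>Entries of the fusion matrix and the R-matrix\<close>

definition fusion_coeff ::
    "real \<Rightarrow> complex \<Rightarrow> complex \<Rightarrow> complex \<Rightarrow> nat \<Rightarrow> nat \<Rightarrow> nat \<Rightarrow> complex" where
  "fusion_coeff q lam \<mu> \<nu> i j l = qpow q (- (of_nat l / 2) * (lam + 1)) / qfact q l *
     (qpow q (of_nat l * wt \<mu> i / 4) *
     (qpow q (of_nat l * wt \<nu> j / 4) / qrising q (- lam + wt \<nu> j) l * e_coeff q \<nu> j l))"

lemma fusion_eq:
  "fusion q lam \<mu> \<nu> =
    lin_ext (\<lambda>(i, j). \<Sum>l\<le>j. scal (fusion_coeff q lam \<mu> \<nu> i j l) (bas (i + l, j - l)))"
  (is "_ = lin_ext ?F")
proof
  fix v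
  define T where "T = (\<lambda>l (i, j). tens
    (((f_act ^^ l) \<circ> h_act \<mu> (\<lambda>h. qpow q (of_nat l * h / 4))) (bas i))
    (((e_act q \<nu> ^^ l) \<circ> h_act \<nu> (\<lambda>h. qpow q (of_nat l * h / 4) / qrising q (- lam + h) l)) (bas j)))"
  have T: "T l (i, j) = scal (qpow q (of_nat l * wt \<mu> i / 4) *
     (qpow q (of_nat l * wt \<nu> j / 4) / qrising q (- lam + wt \<nu> j) l * e_coeff q \<nu> j l))
     (bas (i + l, j - l))" for l i j
    by (simp add: T_def act_simps tens_scal_bas)
  have "fusion q lam \<mu> \<nu> v = Sum_any (\<lambda>l::nat.
     scal (qpow q (- (of_nat l / 2) * (lam + 1)) / qfact q l) (lin_ext (T l) v))"
    by (simp add: fusion_def tens_op_def T_def)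
  also have "\<dots> = lin_ext (\<lambda>k. \<Sum>l\<le>snd k.
     scal (qpow q (- (of_nat l / 2) * (lam + 1)) / qfact q l) (T l k)) v"
    by (rule Sum_any_scal_lin_ext) (auto simp: T e_coeff_eq_0)
  also have "(\<lambda>k. \<Sum>l\<le>snd k.
     scal (qpow q (- (of_nat l / 2) * (lam + 1)) / qfact q l) (T l k)) = ?F"
    by (simp add: fun_eq_iff T fusion_coeff_def)
  finally show "fusion q lam \<mu> \<nu> v = lin_ext ?F v" .
qed

text \<open>The functions of h stand to the left of the powers of e and f, hence are evaluated at
  the shifted indices \<open>i - l\<close> and \<open>j + l\<close>; in \<open>fusion_coeff\<close>
  they act first and see \<open>i\<close> and \<open>j\<close>.\<close>

definition R_coeff :: "real \<Rightarrow> complex \<Rightarrow> complex \<Rightarrow> nat \<Rightarrow> nat \<Rightarrow> nat \<Rightarrow> complex" where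
  "R_coeff q \<mu> \<nu> i j l =
     (1 - inverse (of_real q)) ^ l * qpow q (- (of_nat l * (of_nat l - 1)) / 4) / qfact q l *
     (e_coeff q \<mu> i l * qpow q (of_nat l * wt \<mu> (i - l) / 4) *
      qpow q (- (of_nat l * wt \<nu> (j + l)) / 4)) *
     qpow q (wt \<mu> (i - l) * wt \<nu> (j + l) / 4)"

lemma R_matrix_eq:
  "R_matrix q \<mu> \<nu> =
    lin_ext (\<lambda>(i, j). \<Sum>l\<le>i. scal (R_coeff q \<mu> \<nu> i j l) (bas (i - l, j + l)))"
  (is "_ = lin_ext ?F")
proof
  fix v
  define c :: "nat \<Rightarrow> complex" where "c = (\<lambda>l. (1 - inverse (of_real q)) ^ l *
    qpow q (- (of_nat l * (of_nat l - 1)) / 4) / qfact q l)"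
  define T where "T = (\<lambda>l (i, j). tens
    ((h_act \<mu> (\<lambda>h. qpow q (of_nat l * h / 4)) \<circ> (e_act q \<mu> ^^ l)) (bas i))
    ((h_act \<nu> (\<lambda>h. qpow q (- (of_nat l * h) / 4)) \<circ> (f_act ^^ l)) (bas j)))"
  have T: "T l (i, j) = scal (e_coeff q \<mu> i l * qpow q (of_nat l * wt \<mu> (i - l) / 4) *
      qpow q (- (of_nat l * wt \<nu> (j + l)) / 4)) (bas (i - l, j + l))" for l i j
    using tens_scal_bas[of _ _ "qpow q (- (of_nat l * wt \<nu> (j + l)) / 4)"]
    by (simp add: T_def act_simps)
  have "R_matrix q \<mu> \<nu> v = q_hh q \<mu> \<nu> (Sum_any (\<lambda>l::nat. scal (c l) (lin_ext (T l) v)))"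
    by (simp add: R_matrix_def tens_op_def T_def c_def)
  also have "Sum_any (\<lambda>l::nat. scal (c l) (lin_ext (T l) v)) =
      lin_ext (\<lambda>k. \<Sum>l\<le>fst k. scal (c l) (T l k)) v"
    by (rule Sum_any_scal_lin_ext) (auto simp: T e_coeff_eq_0)
  also have "q_hh q \<mu> \<nu> \<dots> = lin_ext (\<lambda>k. q_hh q \<mu> \<nu> (\<Sum>l\<le>fst k. scal (c l) (T l k))) v"
    by (simp add: lin_ext_def[of _ v] q_hh_def lin_ext_sum lin_ext_scal)
  also have "(\<lambda>k. q_hh q \<mu> \<nu> (\<Sum>l\<le>fst k. scal (c l) (T l k))) = ?F"
    by (auto simp: fun_eq_iff T R_coeff_def c_def q_hh_def lin_ext_sum lin_ext_scal mult_ac)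
  finally show "R_matrix q \<mu> \<nu> v = lin_ext ?F v" .
qed

lemma fusion_coeff_0 [simp]: "fusion_coeff q lam \<mu> \<nu> i j 0 = 1"
  by (simp add: fusion_coeff_def qfact_def qrising_def e_coeff_def qpow_def)

text \<open>The fusion matrix does not change the coefficient at a key with minimal first index.\<close>

lemma fusion_eq_0D:
  assumes "fusion q lam \<mu> \<nu> v = 0"
  shows "v = 0"
proof (rule ccontr)
  let ?K = "Poly_Mapping.keys v"
  assume "v \<noteq> 0"
  then have "?K \<noteq> {}" by simp
  define x where "x = arg_min_on fst ?K"
  have x: "x \<in> ?K" and min: "\<And>y. y \<in> ?K \<Longrightarrow> fst x \<le> fst y"
    using arg_min_if_finite[of ?K fst] \<open>?K \<noteq> {}\<close> by (auto simp: x_def not_less)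
  obtain i j where ij: "x = (i, j)" by (cases x)
  \<comment> \<open>Since \<open>fst x\<close> is minimal, \<open>a + l = fst x\<close> forces
    \<open>l = 0\<close>, and then \<open>(a, b) = x\<close>.\<close>
  have entry: "Poly_Mapping.lookup (\<Sum>l\<le>b. scal (fusion_coeff q lam \<mu> \<nu> a b l) (bas (a + l, b - l))) x
      = (if (a, b) = x then 1 else 0)" if "(a, b) \<in> ?K" for a b
  proof -
    have "Poly_Mapping.lookup (\<Sum>l\<le>b. scal (fusion_coeff q lam \<mu> \<nu> a b l) (bas (a + l, b - l))) x
      = (\<Sum>l\<le>b. if l = 0 \<and> (a, b) = x then 1 else 0)"
      unfolding lookup_sum using min[OF that]
      by (intro sum.cong) (auto simp: lookup_single when_def ij)
    then show ?thesis by (auto simp: if_distrib cong: if_cong)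
  qed
  have "Poly_Mapping.lookup (fusion q lam \<mu> \<nu> v) x =
      (\<Sum>y\<in>?K. if y = x then Poly_Mapping.lookup v y else 0)"
    unfolding fusion_eq lin_ext_def lookup_sum
    by (intro sum.cong refl) (auto simp only: entry lookup_scal split: prod.splits, auto)
  also have "\<dots> = Poly_Mapping.lookup v x"
    using x by simp
  finally show False using assms x by (simp add: in_keys_iff)
qed

text \<open>A linear map with trivial kernel. The diagonal entries are 1 by
  \<open>fusion_coeff_0\<close>, whatever the denominators for \<open>l > 0\<close>. Injectivity is
  what evaluates \<open>inv\<close> on a vector whose preimage is exhibited.\<close>

lemma inj_fusion: "inj (fusion q lam \<mu> \<nu>)"
proof (rule injI)
  fix v w assume *: "fusion q lam \<mu> \<nu> v = fusion q lam \<mu> \<nu> w"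
  have neg: "- w = scal (- 1) w" by (rule poly_mapping_eqI) simp
  have "fusion q lam \<mu> \<nu> (v + - w) = 0"
    using * by (simp only: neg fusion_eq lin_ext_add lin_ext_scal)
      (rule poly_mapping_eqI, simp add: lookup_add)
  then show "v = w" by (auto dest: fusion_eq_0D)
qed

section \<open>The three factors on a weight space\<close>

lemma flip_bas [simp]: "flip (bas (i, j)) = bas (j, i)"
  by (simp add: flip_def)

lemma flip_sum_scal: "flip (\<Sum>i\<in>I. scal (c i) (v i)) = (\<Sum>i\<in>I. scal (c i) (flip (v i)))"
  by (simp add: flip_def lin_ext_sum lin_ext_scal)

lemma fusion_sum_scal:
  "fusion q lam \<mu> \<nu> (\<Sum>i\<in>I. scal (c i) (v i)) = (\<Sum>i\<in>I. scal (c i) (fusion q lam \<mu> \<nu> (v i)))"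
  by (simp add: fusion_eq lin_ext_sum lin_ext_scal)

lemma R_matrix_sum_scal:
  "R_matrix q \<mu> \<nu> (\<Sum>i\<in>I. scal (c i) (v i)) = (\<Sum>i\<in>I. scal (c i) (R_matrix q \<mu> \<nu> (v i)))"
  by (simp add: R_matrix_eq lin_ext_sum lin_ext_scal)

lemma fusion_bas:
  assumes "i \<le> s"
  shows "fusion q lam \<mu> \<nu> (bas (i, s - i)) =
    (\<Sum>m\<in>{i..s}. scal (fusion_coeff q lam \<mu> \<nu> i (s - i) (m - i)) (bas (m, s - m)))"
  unfolding fusion_eq using assms
  by (auto intro!: sum.reindex_bij_witness[of _ "\<lambda>m. m - i" "\<lambda>l. i + l"])

lemma flip_fusion_flip_bas:
  assumes "n \<le> s"
  shows "flip (fusion q lam \<delta> \<gamma> (flip (bas (n, s - n)))) =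
    (\<Sum>k\<le>n. scal (fusion_coeff q lam \<delta> \<gamma> (s - n) n (n - k)) (bas (k, s - k)))"
  unfolding fusion_eq using assms
  by (auto simp: flip_sum_scal intro!: sum.reindex_bij_witness[of _ "\<lambda>k. n - k" "\<lambda>l. n - l"])

lemma flip_R_matrix_flip_bas:
  assumes "k \<le> s"
  shows "flip (R_matrix q \<delta> \<gamma> (flip (bas (k, s - k)))) =
    (\<Sum>m\<in>{k..s}. scal (R_coeff q \<delta> \<gamma> (s - k) k (m - k)) (bas (m, s - m)))"
  unfolding R_matrix_eq using assms
  by (auto simp: flip_sum_scal add.commute intro!: sum.reindex_bij_witness[of _ "\<lambda>m. m - k" "\<lambda>l. k + l"])

text \<open>\<open>L\<close> is the matrix of \<open>J\<^sup>-\<^sup>1 (P R P)\<close> on a weight space.\<close>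

lemma exchange_elem_eq_sum:
  assumes "m \<le> s" "n \<le> s"
    and L: "\<And>k m. k \<le> m \<Longrightarrow> m \<le> s \<Longrightarrow>
      (\<Sum>i\<in>{k..m}. fusion_coeff q lam \<gamma> \<delta> i (s - i) (m - i) * L i k) =
      R_coeff q \<delta> \<gamma> (s - k) k (m - k)"
  shows "exchange_elem q \<gamma> \<delta> s m n lam =
    (\<Sum>k\<le>min m n. L m k * fusion_coeff q lam \<delta> \<gamma> (s - n) n (n - k))"
proof -
  let ?J = "fusion q lam \<gamma> \<delta>"
  let ?b = "\<lambda>k. bas (k, s - k) :: verma2"
  let ?u = "\<lambda>k. fusion_coeff q lam \<delta> \<gamma> (s - n) n (n - k)"
  \<comment> \<open>\<open>w k\<close> is column \<open>k\<close> of \<open>L\<close> as a vector,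
    the intended preimage under \<open>?J\<close> of the flipped R-matrix applied to
    \<open>?b k\<close>.\<close>
  define w where "w k = (\<Sum>i\<in>{k..s}. scal (L i k) (?b i))" for k
  have w: "?J (w k) = flip (R_matrix q \<delta> \<gamma> (flip (?b k)))" if "k \<le> s" for k
  proof -
    have "?J (w k) = (\<Sum>i\<in>{k..s}. \<Sum>m\<in>{i..s}.
        scal (L i k * fusion_coeff q lam \<gamma> \<delta> i (s - i) (m - i)) (?b m))"
      unfolding w_def fusion_sum_scal
      by (intro sum.cong refl) (simp add: fusion_bas scal_sum_right)
    \<comment> \<open>Both double sums run over the triangle k \<le> i \<le> m \<le> s; with
      \<open>m\<close> outside, the inner sum is the one in the hypothesis on
      \<open>L\<close>.\<close>
    also have "\<dots> = (\<Sum>m\<in>{k..s}. \<Sum>i\<in>{k..m}.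
        scal (L i k * fusion_coeff q lam \<gamma> \<delta> i (s - i) (m - i)) (?b m))"
      unfolding sum.Sigma[OF finite_atLeastAtMost ballI[OF finite_atLeastAtMost]]
      by (rule sum.reindex_bij_witness[of _ prod.swap prod.swap]) auto
    also have "\<dots> = (\<Sum>m\<in>{k..s}. scal (R_coeff q \<delta> \<gamma> (s - k) k (m - k)) (?b m))"
    proof (rule sum.cong[OF refl])
      fix m assume "m \<in> {k..s}"
      with L[of k m] show "(\<Sum>i\<in>{k..m}.
        scal (L i k * fusion_coeff q lam \<gamma> \<delta> i (s - i) (m - i)) (?b m)) =
        scal (R_coeff q \<delta> \<gamma> (s - k) k (m - k)) (?b m)"
        by (simp add: scal_sum_left[symmetric] mult.commute)
    qed
    also have "\<dots> = flip (R_matrix q \<delta> \<gamma> (flip (?b k)))"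
      using that by (simp only: flip_R_matrix_flip_bas)
    finally show ?thesis .
  qed
  \<comment> \<open>The coefficients \<open>?u k\<close> are column \<open>n\<close> of the upper
    triangular factor, so by linearity this exhibits a preimage of the vector to which
    \<open>inv ?J\<close> is applied.\<close>
  have "?J (\<Sum>k\<le>n. scal (?u k) (w k)) = (\<Sum>k\<le>n. scal (?u k) (flip (R_matrix q \<delta> \<gamma> (flip (?b k)))))"
    unfolding fusion_sum_scal using \<open>n \<le> s\<close> by (intro sum.cong) (auto simp: w)
  also have "\<dots> = flip (R_matrix q \<delta> \<gamma> (flip (flip (fusion q lam \<delta> \<gamma> (flip (?b n))))))"
    using \<open>n \<le> s\<close> by (simp only: flip_fusion_flip_bas flip_sum_scal R_matrix_sum_scal)
  finally have "exchange q \<gamma> \<delta> lam (?b n) = inv ?J (?J (\<Sum>k\<le>n. scal (?u k) (w k)))"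
    by (simp add: exchange_def)
  also have "\<dots> = (\<Sum>k\<le>n. scal (?u k) (w k))"
    by (rule inv_f_f[OF inj_fusion])
  finally have "exchange q \<gamma> \<delta> lam (?b n) = (\<Sum>k\<le>n. scal (?u k) (w k))" .
  moreover have "(i = m \<and> s - i = s - m) = (i = m)" for i by auto
  ultimately have "exchange_elem q \<gamma> \<delta> s m n lam =
      (\<Sum>k\<le>n. ?u k * (\<Sum>i\<in>{k..s}. L i k * (if i = m then 1 else 0)))"
    by (simp add: exchange_elem_def tens_bas w_def lookup_sum lookup_single when_def)
  \<comment> \<open>The index \<open>m\<close> lies in \<open>{k..s}\<close> only for k \<le> m,
    whence the range up to \<open>min m n\<close>.\<close>
  also have "\<dots> = (\<Sum>k\<le>n. if k \<le> m then ?u k * L m k else 0)"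
    using \<open>m \<le> s\<close> by (intro sum.cong) (auto simp: mult_delta_right)
  also have "\<dots> = (\<Sum>k\<le>min m n. L m k * ?u k)"
    by (rule sum.mono_neutral_cong_right) auto
  finally show ?thesis .
qed

section \<open>Products of \<open>q\<close>-numbers as \<open>q\<close>-shifted factorials\<close>

lemma qpow_0 [simp]: "qpow q 0 = 1"
  by (simp add: qpow_def)

lemma qpow_add: "qpow q (a + b) = qpow q a * qpow q b"
  by (simp add: qpow_def distrib_right exp_add)

lemma qpow_nonzero [simp]: "qpow q a \<noteq> 0"
  by (simp add: qpow_def)

lemma qpow_minus: "qpow q (- a) = inverse (qpow q a)"
  by (simp add: qpow_def exp_minus)

lemma qpow_diff: "qpow q (a - b) = qpow q a / qpow q b"
  by (simp add: qpow_def left_diff_distrib exp_diff)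

lemma qpow_power: "qpow q a ^ n = qpow q (of_nat n * a)"
  by (simp add: qpow_def exp_of_nat_mult[symmetric] mult.assoc)

lemma qpow_of_nat: "0 < q \<Longrightarrow> qpow q (of_nat n) = of_real q ^ n"
  by (simp add: qpow_def exp_of_nat_mult exp_of_real)

lemma qpow_1: "0 < q \<Longrightarrow> qpow q 1 = of_real q"
  using qpow_of_nat[of q 1] by simp

lemma of_real_power_neq_1: "0 < q \<Longrightarrow> q < 1 \<Longrightarrow> 0 < n \<Longrightarrow> complex_of_real q ^ n \<noteq> 1"
  by (metis of_real_eq_1_iff of_real_power power_less_one_iff less_irrefl less_imp_le)

lemma qnum_eq:
  assumes "0 < q" "q < 1"
  shows "qnum q a = qpow q ((1 - a) / 2) * (1 - qpow q a) / (1 - of_real q)"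
proof -
  define x y where "x = qpow q (a / 2)" and "y = qpow q (1 / 2)"
  have nz: "x \<noteq> 0" "y \<noteq> 0" by (simp_all add: x_def y_def)
  have a: "qpow q a = x\<^sup>2" and q: "of_real q = y\<^sup>2"
    using assms by (simp_all add: x_def y_def qpow_power qpow_1)
  have "y\<^sup>2 \<noteq> 1" using assms unfolding q[symmetric] by simp
  moreover have "qpow q ((1 - a) / 2) = y / x"
    by (simp add: x_def y_def qpow_diff diff_divide_distrib)
  ultimately show ?thesis using nz
    unfolding a q qnum_def
    by (simp add: qpow_minus flip: x_def y_def) (simp add: field_simps power2_eq_square)
qed

lemma qpoch_0 [simp]: "qpoch a q 0 = 1"
  by (simp add: qpoch_def)

lemma qpoch_Suc: "qpoch a q (Suc k) = qpoch a q k * (1 - a * of_real q ^ k)"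
  by (simp add: qpoch_def)

lemma qpoch_add: "qpoch a q (j + k) = qpoch a q j * qpoch (a * of_real q ^ j) q k"
  by (induction k) (simp_all add: qpoch_Suc power_add mult_ac)

lemma qpoch_Suc': "qpoch a q (Suc k) = (1 - a) * qpoch (a * of_real q) q k"
  using qpoch_add[of a q 1 k] by (simp add: qpoch_Suc)

lemma qpoch_eq_0_iff: "qpoch a q k = 0 \<longleftrightarrow> (\<exists>i<k. a * of_real q ^ i = 1)"
  by (auto simp: qpoch_def)

lemma qpoch_q_nonzero:
  assumes "0 < q" "q < 1"
  shows "qpoch (of_real q) q k \<noteq> 0"
  using of_real_power_neq_1[OF assms, of "Suc i" for i] by (auto simp: qpoch_eq_0_iff)

lemma qrising_eq:
  assumes "0 < q" "q < 1"
  shows "qrising q a k = qpow q (of_nat k * (1 - a) / 2 - of_nat k * (of_nat k - 1) / 4) *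
    qpoch (qpow q a) q k / (1 - of_real q) ^ k"
proof (induction k)
  case 0
  then show ?case by (simp add: qrising_def)
next
  case (Suc k)
  have "qpow q (of_nat (Suc k) * (1 - a) / 2 - of_nat (Suc k) * (of_nat (Suc k) - 1) / 4) =
    qpow q (of_nat k * (1 - a) / 2 - of_nat k * (of_nat k - 1) / 4) * qpow q ((1 - (a + of_nat k)) / 2)"
    unfolding qpow_add[symmetric] by (rule arg_cong[of _ _ "qpow q"]) (simp add: field_simps)
  moreover have "qrising q a (Suc k) = qrising q a k * qnum q (a + of_nat k)"
    by (simp add: qrising_def)
  moreover have "qpow q (a + of_nat k) = qpow q a * of_real q ^ k"
    using assms by (simp add: qpow_add qpow_of_nat)
  ultimately show ?case
    using assms by (simp add: Suc qpoch_Suc qnum_eq mult_ac)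
qed

lemma qfact_eq:
  assumes "0 < q" "q < 1"
  shows "qfact q k = qpow q (- of_nat k * (of_nat k - 1) / 4) *
    qpoch (of_real q) q k / (1 - of_real q) ^ k"
proof -
  have "qfact q k = qrising q 1 k"
    by (simp add: qfact_def qrising_def prod.atLeast1_atMost_eq)
  also have "\<dots> = qpow q (- of_nat k * (of_nat k - 1) / 4) *
    qpoch (of_real q) q k / (1 - of_real q) ^ k"
    using assms by (simp add: qrising_eq qpow_1)
  finally show ?thesis .
qed

text \<open>Each factor 1 - z becomes - z (1 - 1/z), and the inverted factors appear in reverse
  order, starting from the last one.\<close>

lemma qpoch_reflect:
  assumes "0 < q"
  shows "qpoch (qpow q x) q l = (- 1) ^ l * qpow q (of_nat l * x + of_nat l * (of_nat l - 1) / 2) *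
    qpoch (qpow q (1 - x - of_nat l)) q l"
proof (induction l)
  case 0
  then show ?case by simp
next
  case (Suc l)
  \<comment> \<open>The base on the right moves with \<open>l\<close>: the new factor comes first,
    and the remaining product starts at the old base.\<close>
  have 1: "qpow q (1 - x - of_nat (Suc l)) * of_real q = qpow q (1 - x - of_nat l)"
    unfolding qpow_1[OF assms, symmetric] qpow_add[symmetric] by (simp add: algebra_simps)
  have 2: "qpow q (of_nat (Suc l) * x + of_nat (Suc l) * (of_nat (Suc l) - 1) / 2) =
    qpow q (of_nat l * x + of_nat l * (of_nat l - 1) / 2) * qpow q (x + of_nat l)"
    unfolding qpow_add[symmetric] by (rule arg_cong[of _ _ "qpow q"]) (simp add: field_simps)
  have 3: "qpow q x * of_real q ^ l = qpow q (x + of_nat l)"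
    using assms by (simp add: qpow_add qpow_of_nat)
  have 4: "qpow q (1 - x - of_nat (Suc l)) = inverse (qpow q (x + of_nat l))"
    unfolding qpow_minus[symmetric] by simp
  have "qpoch (qpow q x) q (Suc l) = qpoch (qpow q x) q l * (1 - qpow q (x + of_nat l))"
    by (simp add: qpoch_Suc 3)
  moreover have "qpoch (qpow q (1 - x - of_nat (Suc l))) q (Suc l) =
    (1 - inverse (qpow q (x + of_nat l))) * qpoch (qpow q (1 - x - of_nat l)) q l"
    unfolding qpoch_Suc' 1 by (simp only: 4)
  moreover have "(- 1) ^ l * P * B * (1 - z) = (- 1) ^ Suc l * (P * z) * ((1 - inverse z) * B)"
    if "z \<noteq> 0" for P B z :: complex
    using that by (simp add: field_simps)
  ultimately show ?case
    unfolding 2 Suc by simp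
qed

text \<open>Reflection sends the base q^(-s) to q^(1 + s - j), and the reflected product consists of
  the last \<open>j\<close> factors of (q;q)_s.\<close>

lemma qpoch_neg_nat:
  assumes "0 < q" "q < 1" "j \<le> s"
  shows "qpoch (qpow q (- of_nat s)) q j =
    (- 1) ^ j * qpow q (of_nat j * (of_nat j - 1) / 2 - of_nat s * of_nat j) *
    qpoch (of_real q) q s / qpoch (of_real q) q (s - j)"
proof -
  have "of_real q * of_real q ^ (s - j) = qpow q (1 + of_nat s - of_nat j)"
    using qpow_of_nat[OF assms(1), of "Suc (s - j)"] assms by (simp add: of_nat_diff algebra_simps)
  then have "qpoch (of_real q) q s = qpoch (of_real q) q (s - j) * qpoch (qpow q (1 + of_nat s - of_nat j)) q j"
    using qpoch_add[of "of_real q" q "s - j" j] assms by simp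
  then show ?thesis
    using qpoch_reflect[OF assms(1), of "- of_nat s" j] qpoch_q_nonzero[OF assms(1,2), of "s - j"]
    by (simp add: algebra_simps)
qed

section \<open>Closed forms of the coefficients\<close>

lemma e_coeff_eq:
  assumes q: "0 < q" "q < 1" and "l \<le> k"
  shows "e_coeff q \<mu> k l = qpow q (of_nat l * (1 - \<mu>) / 2) *
    (qpoch (of_real q) q k / qpoch (of_real q) q (k - l)) *
    qpoch (qpow q (\<mu> - of_nat k + 1)) q l / (1 - of_real q) ^ (2 * l)"
proof -
  \<comment> \<open>The falling product [k] [k-1] ... [k-l+1], read backwards, is a rising one that
    starts at k - l + 1.\<close>
  have eq: "qrising q (of_nat (k - l) + 1) l = (\<Prod>u<l. qnum q (of_nat k - of_nat u))"
    unfolding qrising_def using \<open>l \<le> k\<close>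
    by (intro prod.reindex_bij_witness[of _ "\<lambda>u. l - Suc u" "\<lambda>u. l - Suc u"])
       (auto simp: of_nat_diff Suc_le_eq algebra_simps)
  have "e_coeff q \<mu> k l = qrising q (of_nat (k - l) + 1) l * qrising q (\<mu> - of_nat k + 1) l"
    unfolding eq by (simp add: e_coeff_def prod.distrib qrising_def add_ac)
  moreover have "qpow q (of_nat (k - l) + 1) = of_real q * of_real q ^ (k - l)"
    using q by (simp add: qpow_add qpow_of_nat qpow_1)
  then have "qpoch (qpow q (of_nat (k - l) + 1)) q l = qpoch (of_real q) q k / qpoch (of_real q) q (k - l)"
    using qpoch_add[of "of_real q" q "k - l" l] \<open>l \<le> k\<close> qpoch_q_nonzero[OF q, of "k - l"] by simp
  moreover have "qpow q (of_nat l * (1 - \<mu>) / 2) =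
     qpow q (of_nat l * (1 - (of_nat (k - l) + 1)) / 2 - of_nat l * (of_nat l - 1) / 4) *
     qpow q (of_nat l * (1 - (\<mu> - of_nat k + 1)) / 2 - of_nat l * (of_nat l - 1) / 4)"
    unfolding qpow_add[symmetric] using \<open>l \<le> k\<close>
    by (intro arg_cong[of _ _ "qpow q"]) (simp add: of_nat_diff field_simps)
  ultimately show ?thesis
    by (simp add: qrising_eq[OF q] mult_2 mult_2_right power_add mult_ac)
qed

text \<open>Gathers all powers of q in one exponent. \<open>e_coeff\<close> stays unexpanded so that
  \<open>e_coeff_mult\<close> can later merge it with the one from \<open>R_coeff\<close>.\<close>

lemma fusion_coeff_eq:
  assumes q: "0 < q" "q < 1"
  shows "fusion_coeff q lam \<mu> \<nu> i j l =
    qpow q (of_nat l * (- lam - 1 + (wt \<mu> i + wt \<nu> j) / 2 - (1 + lam - wt \<nu> j) + (of_nat l - 1)) / 2) *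
    (1 - of_real q) ^ (2 * l) * e_coeff q \<nu> j l /
    (qpoch (of_real q) q l * qpoch (qpow q (wt \<nu> j - lam)) q l)"
proof -
  have "qpow q (of_nat l * (- lam - 1 + (wt \<mu> i + wt \<nu> j) / 2 - (1 + lam - wt \<nu> j) + (of_nat l - 1)) / 2) =
    qpow q (- (of_nat l / 2) * (lam + 1)) / qpow q (- of_nat l * (of_nat l - 1) / 4) *
    qpow q (of_nat l * wt \<mu> i / 4) * qpow q (of_nat l * wt \<nu> j / 4) /
    qpow q (of_nat l * (1 - (- lam + wt \<nu> j)) / 2 - of_nat l * (of_nat l - 1) / 4)"
    (is "_ = ?A / ?F * ?B * ?C / ?G")
    unfolding qpow_add[symmetric] qpow_diff[symmetric]
    by (intro arg_cong[of _ _ "qpow q"]) (simp add: field_simps)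
  then have "qpow q (of_nat l * (- lam - 1 + (wt \<mu> i + wt \<nu> j) / 2 - (1 + lam - wt \<nu> j) + (of_nat l - 1)) / 2) *
      (1 - of_real q) ^ (2 * l) * e_coeff q \<nu> j l /
      (qpoch (of_real q) q l * qpoch (qpow q (wt \<nu> j - lam)) q l) = ?A / ?F * ?B * ?C / ?G *
      ((1 - of_real q) ^ l * (1 - of_real q) ^ l) * e_coeff q \<nu> j l /
      (qpoch (of_real q) q l * qpoch (qpow q (- lam + wt \<nu> j)) q l)"
    by (simp only: mult_2 power_add add.commute[of "- lam"] diff_conv_add_uminus[of "wt \<nu> j"])
  \<comment> \<open>The rearrangement with atoms as variables; \<open>c\<close> stands for (1 -
    q)^l, which enters once through \<open>qfact_eq\<close> and once through
    \<open>qrising_eq\<close>.\<close>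
  moreover have "a / (f * x / c) * (b * (c' / (g * y / c) * e)) = a / f * b * c' / g * (c * c) * e / (x * y)"
    for a b c c' e f g x y :: complex
    by (simp add: mult_ac)
  ultimately show ?thesis
    by (simp only: fusion_coeff_def qfact_eq[OF q] qrising_eq[OF q])
qed

text \<open>The factor 1 - 1/q equals - (1 - q)/q, which accounts for the sign and for
  \<open>- of_nat l\<close> in the exponent; the power of q quadratic in \<open>l\<close> cancels
  against the one in \<open>qfact_eq\<close>.\<close>

lemma R_coeff_eq:
  assumes q: "0 < q" "q < 1"
  shows "R_coeff q \<mu> \<nu> i j l = (- 1) ^ l *
    qpow q (of_nat l * (wt \<mu> (i - l) - wt \<nu> (j + l)) / 4 + wt \<mu> (i - l) * wt \<nu> (j + l) / 4 - of_nat l) *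
    (1 - of_real q) ^ (2 * l) * e_coeff q \<mu> i l / qpoch (of_real q) q l"
proof -
  have "1 - inverse (of_real q) = (- 1) * inverse (of_real q) * (1 - complex_of_real q)"
    using q by (simp add: field_simps)
  then have 1: "(1 - inverse (of_real q)) ^ l = (- 1) ^ l * qpow q (- of_nat l) * (1 - complex_of_real q) ^ l"
    by (simp only: power_mult_distrib power_inverse qpow_minus qpow_of_nat[OF q(1)])
  have "qpow q (of_nat l * (wt \<mu> (i - l) - wt \<nu> (j + l)) / 4 + wt \<mu> (i - l) * wt \<nu> (j + l) / 4 - of_nat l) =
    qpow q (- of_nat l) * (qpow q (- (of_nat l * (of_nat l - 1)) / 4) / qpow q (- of_nat l * (of_nat l - 1) / 4)) *
    qpow q (of_nat l * wt \<mu> (i - l) / 4) * qpow q (- (of_nat l * wt \<nu> (j + l)) / 4) *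
    qpow q (wt \<mu> (i - l) * wt \<nu> (j + l) / 4)"
    (is "_ = ?A * (?B / ?C) * ?D * ?E * ?F")
    unfolding qpow_add[symmetric] qpow_diff[symmetric]
    by (intro arg_cong[of _ _ "qpow q"]) (simp add: field_simps)
  moreover have "m * a * x * b / (c * p / x) * (e * d * e') * f = m * (a * (b / c) * d * e' * f) * (x * x) * e / p"
    for a b c d e e' f m p x :: complex
    by (simp add: mult_ac)
  ultimately show ?thesis
    by (simp only: R_coeff_def 1 qfact_eq[OF q] mult_2 power_add)
qed

section \<open>The very-well-poised summation\<close>

text \<open>For \<open>t = 0\<close> the truncated exponent \<open>t - 1\<close> occurs only in an empty product.\<close>

definition vwp_term :: "real \<Rightarrow> complex \<Rightarrow> nat \<Rightarrow> nat \<Rightarrow> complex" where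
  "vwp_term q y N t = (- 1) ^ (N + t) * y ^ (N - t) * of_real q ^ (N choose 2) / of_real q ^ (t choose 2) *
     (qpoch (of_real q) q N / (qpoch (of_real q) q t * qpoch (of_real q) q (N - t))) /
     (qpoch (y * of_real q ^ (2 * t)) q (N - t) * qpoch (y * of_real q ^ (t - 1)) q t)"

text \<open>The certificate of the telescoping in the induction on \<open>N\<close>.\<close>

definition vwp_cert :: "real \<Rightarrow> complex \<Rightarrow> nat \<Rightarrow> nat \<Rightarrow> complex" where
  "vwp_cert q y N t = - ((- 1) ^ (N + t) * y ^ (N - t) * of_real q ^ (N choose 2) / of_real q ^ (t choose 2) *
     (qpoch (of_real q) q N / (qpoch (of_real q) q t * qpoch (of_real q) q (N - t))) /
     qpoch (y * of_real q ^ t) q (N + 1))"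

lemma choose_two_Suc: "Suc N choose 2 = (N choose 2) + N"
  by (simp add: numeral_2_eq_2)


text \<open>The relation of \<open>vwp_term_step\<close> at the lower end, where the preceding
  certificate counts as 0.\<close>

lemma vwp_term_first:
  assumes q: "0 < q" "q < 1" and y: "\<And>j. j \<le> N \<Longrightarrow> y * of_real q ^ j \<noteq> 1"
  shows "vwp_term q y (Suc N) 0 = vwp_term q y N 0 + vwp_cert q y N 0"
proof -
  define c where "c = complex_of_real q"
  define X where "X = c ^ N"
  have P: "qpoch c q k \<noteq> 0" for k unfolding c_def using q by (rule qpoch_q_nonzero)
  have nz: "1 - y * X \<noteq> 0" "qpoch y q N \<noteq> 0" "X * c \<noteq> 1"
    using y of_real_power_neq_1[OF q, of "Suc N"] by (auto simp: X_def c_def qpoch_eq_0_iff mult.commute)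
  show ?thesis
    unfolding vwp_term_def vwp_cert_def c_def[symmetric] choose_two_Suc
    using P nz
    by (simp add: qpoch_Suc power_add flip: c_def X_def) (simp add: field_simps)
qed

text \<open>The upper end of the same relation. It is separate because \<open>N - Suc N\<close>
  truncates to 0, so the expressions for \<open>vwp_term q y N (Suc N)\<close> and
  \<open>vwp_cert q y N (Suc N)\<close> do not vanish by themselves.\<close>

lemma vwp_term_last:
  assumes q: "0 < q" "q < 1"
  shows "vwp_term q y (Suc N) (Suc N) = - vwp_cert q y N N"
  using q qpoch_q_nonzero[OF q, of N] qpoch_q_nonzero[OF q, of "Suc N"]
  by (simp add: vwp_term_def vwp_cert_def)

text \<open>All four quantities are written as multiples of \<open>K\<close>, with factors rational
  in \<open>y\<close>, \<open>c\<close>, \<open>T\<close>, \<open>U\<close> (\<open>A1\<close>,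
  \<open>G1\<close>, \<open>G0\<close>). What remains is one rational identity.\<close>

lemma vwp_term_step:
  assumes q: "0 < q" "q < 1" and y: "\<And>j. j \<le> 2 * N \<Longrightarrow> y * of_real q ^ j \<noteq> 1"
    and N: "N = Suc r + u"
  shows "vwp_term q y (Suc N) (Suc r) = vwp_term q y N (Suc r) + vwp_cert q y N (Suc r) - vwp_cert q y N r"
proof -
  define c where "c = complex_of_real q"
  define T U where "T = c ^ r" and "U = c ^ u"
  define K where "K = vwp_term q y N (Suc r)"
  define D where "D = qpoch (y * c ^ (2 * Suc r)) q u * qpoch (y * c ^ r) q (Suc r)"
  have c: "c \<noteq> 0" using q by (simp add: c_def)
  have T: "T \<noteq> 0" using c by (simp add: T_def)
  have P: "qpoch c q k \<noteq> 0" for k unfolding c_def using q by (rule qpoch_q_nonzero)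
  have U: "1 - c * U \<noteq> 0"
    using of_real_power_neq_1[OF q, of "Suc u"] by (simp add: U_def c_def)
  have Y: "1 - y * c ^ j \<noteq> 0" if "j \<le> 2 * N" for j
    using y[OF that] by (simp add: c_def)
  have pows: "c ^ N = c * T * U" "c ^ Suc r = c * T" "c ^ (2 * r + 1) = c * T\<^sup>2"
      "c ^ (2 * Suc r) = c\<^sup>2 * T\<^sup>2" "c ^ (2 * r + 2 + u) = c\<^sup>2 * T\<^sup>2 * U"
    by (simp_all add: N T_def U_def power_add mult_2 mult_2_right power2_eq_square mult_ac)
  have nz: "1 - y * (c * T\<^sup>2) \<noteq> 0" "1 - y * T \<noteq> 0" "1 - y * (c\<^sup>2 * T\<^sup>2 * U) \<noteq> 0"
    using Y[of "2 * r + 1"] Y[of r] Y[of "2 * r + 2 + u"]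
    by (simp_all only: pows T_def[symmetric]) (simp_all add: N)
  have D: "D \<noteq> 0"
  proof -
    have "y * c ^ (2 * Suc r) * c ^ i \<noteq> 1" if "i < u" for i
      using y[of "2 * Suc r + i"] that by (simp add: N c_def power_add mult.assoc)
    moreover have "y * c ^ r * c ^ i \<noteq> 1" if "i < Suc r" for i
      using y[of "r + i"] that by (simp add: N c_def power_add mult.assoc)
    ultimately show ?thesis by (simp add: D_def qpoch_eq_0_iff flip: c_def)
  qed
  \<comment> \<open>The exponents of \<open>c\<close> on the left run from r to 2r + 1 + u;
    \<open>D\<close> covers all of them except 2r + 1.\<close>
  have E0: "qpoch (y * c ^ r) q (N + 1) = D * (1 - y * (c * T\<^sup>2))"
  proof -
    have "qpoch (y * c ^ r) q (N + 1) = qpoch (y * c ^ r) q (Suc r + Suc u)"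
      by (simp add: N)
    also have "\<dots> = qpoch (y * c ^ r) q (Suc r) * qpoch (y * c ^ (2 * r + 1)) q (Suc u)"
      unfolding qpoch_add c_def[symmetric] by (simp add: power_add mult_2 mult_2_right mult_ac)
    also have "qpoch (y * c ^ (2 * r + 1)) q (Suc u) =
        (1 - y * (c * T\<^sup>2)) * qpoch (y * c ^ (2 * Suc r)) q u"
      unfolding qpoch_Suc' c_def[symmetric] pows by (simp add: power2_eq_square mult_ac)
    finally show ?thesis by (simp add: D_def)
  qed
  \<comment> \<open>Against \<open>E0\<close> the window of exponents moves up by one: r drops out
    and 2r + 2 + u enters.\<close>
  have E1: "qpoch (y * c ^ Suc r) q (N + 1) * (1 - y * T) =
      D * (1 - y * (c * T\<^sup>2)) * (1 - y * (c\<^sup>2 * T\<^sup>2 * U))"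
  proof -
    have "(1 - y * T) * qpoch (y * c ^ Suc r) q (N + 1) = qpoch (y * c ^ r) q (Suc (N + 1))"
      by (simp only: qpoch_Suc'[of "y * c ^ r"] T_def c_def[symmetric] power_Suc mult_ac)
    also have "\<dots> = D * (1 - y * (c * T\<^sup>2)) * (1 - y * (c ^ r * c ^ (N + 1)))"
      by (simp only: qpoch_Suc[of _ _ "N + 1"] E0 c_def[symmetric] mult_ac)
    also have "c ^ r * c ^ (N + 1) = c\<^sup>2 * T\<^sup>2 * U"
      by (simp add: N T_def U_def power_add power2_eq_square mult_ac)
    finally show ?thesis by (simp add: mult.commute)
  qed
  have K_eq: "K = (- 1) ^ (N + Suc r) * y ^ u * c ^ (N choose 2) / c ^ (Suc r choose 2) *
      (qpoch c q N / (qpoch c q (Suc r) * qpoch c q u)) / D"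
    by (simp add: K_def vwp_term_def D_def N c_def)
  have A1: "vwp_term q y (Suc N) (Suc r) =
      - K * y * (c * T * U) * (1 - c * (c * T * U)) / ((1 - c * U) * (1 - y * (c\<^sup>2 * T\<^sup>2 * U)))"
  proof -
    have "qpoch (y * c ^ (2 * Suc r)) q (Suc u) * qpoch (y * c ^ r) q (Suc r) =
        D * (1 - y * (c\<^sup>2 * T\<^sup>2 * U))"
      unfolding qpoch_Suc[of _ _ u] c_def[symmetric] D_def pows U_def[symmetric] by (simp add: mult_ac)
    moreover have "Suc N - Suc r = Suc u" by (simp add: N)
    ultimately have "vwp_term q y (Suc N) (Suc r) =
        (- 1) ^ (Suc N + Suc r) * y ^ Suc u * c ^ ((N choose 2) + N) / c ^ (Suc r choose 2) *
      (qpoch c q (Suc N) / (qpoch c q (Suc r) * qpoch c q (Suc u))) / (D * (1 - y * (c\<^sup>2 * T\<^sup>2 * U)))"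
      unfolding vwp_term_def c_def[symmetric] choose_two_Suc[of N] by (simp only: diff_Suc_1)
    then show ?thesis
      unfolding K_eq power_add[of c] pows qpoch_Suc[of c q N] qpoch_Suc[of c q u] c_def[symmetric] U_def[symmetric]
      by (simp add: mult_ac)
  qed
  have G1: "vwp_cert q y N (Suc r) = - K * (1 - y * T) / ((1 - y * (c * T\<^sup>2)) * (1 - y * (c\<^sup>2 * T\<^sup>2 * U)))"
  proof -
    have E: "qpoch (y * c ^ Suc r) q (N + 1) =
        D * ((1 - y * (c * T\<^sup>2)) * (1 - y * (c\<^sup>2 * T\<^sup>2 * U))) / (1 - y * T)"
      using E1 nz by (simp add: field_simps)
    have "N - Suc r = u" by (simp add: N)
    then show ?thesis
      unfolding vwp_cert_def c_def[symmetric] E K_eq by simp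
  qed
  have G0: "vwp_cert q y N r = K * y * T * (1 - c * T) / ((1 - c * U) * (1 - y * (c * T\<^sup>2)))"
  proof -
    have "N - r = Suc u" by (simp add: N)
    then have *: "vwp_cert q y N r = - ((- 1) ^ (N + r) * y ^ Suc u * c ^ (N choose 2) / c ^ (r choose 2) *
        (qpoch c q N / (qpoch c q r * qpoch c q (Suc u))) / (D * (1 - y * (c * T\<^sup>2))))"
      by (simp only: vwp_cert_def c_def[symmetric] E0)
    have "1 - c * T \<noteq> 0"
      using of_real_power_neq_1[OF q, of "Suc r"] by (simp add: T_def c_def)
    then show ?thesis
      unfolding * K_eq choose_two_Suc power_add[of c] qpoch_Suc[of c q r] qpoch_Suc[of c q u]
        c_def[symmetric] T_def[symmetric] U_def[symmetric] using T
      by (simp add: mult_ac)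
  qed
  show ?thesis
    unfolding A1 G1 G0 K_def[symmetric] using nz U
    by (simp add: divide_simps) (simp add: algebra_simps power2_eq_square)
qed

text \<open>By induction on \<open>N\<close>: passing to \<open>Suc N\<close> changes the sum by a
  telescoping sum of certificates, which is 0. The largest exponent of q in the denominators is 2N -
  2; the form \<open>j + 2 \<le> 2 * N\<close> makes the condition void for
  \<open>N = 0\<close>.\<close>

lemma sum_vwp_term:
  assumes q: "0 < q" "q < 1"
  shows "(\<And>j. j + 2 \<le> 2 * N \<Longrightarrow> y * of_real q ^ j \<noteq> 1) \<Longrightarrow> (\<Sum>t\<le>N. vwp_term q y N t) = 1"
proof (induction N)
  case 0
  then show ?case by (simp add: vwp_term_def)
next
  case (Suc N)
  have y: "y * of_real q ^ j \<noteq> 1" if "j \<le> 2 * N" for j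
    using Suc.prems[of j] that by simp
  have step: "vwp_term q y (Suc N) (Suc r) =
      vwp_term q y N (Suc r) + (vwp_cert q y N (Suc r) - vwp_cert q y N r)" if "r < N" for r
    using vwp_term_step[OF q y, of N r "N - Suc r"] that by simp
  have split: "(\<Sum>t\<le>N. f t) = f 0 + (\<Sum>r<N. f (Suc r))" for f :: "nat \<Rightarrow> complex"
    by (simp only: lessThan_Suc_atMost[symmetric] sum.lessThan_Suc_shift)
  have "(\<Sum>t\<le>Suc N. vwp_term q y (Suc N) t) =
      vwp_term q y (Suc N) 0 + (\<Sum>r<N. vwp_term q y (Suc N) (Suc r)) + vwp_term q y (Suc N) (Suc N)"
    by (simp add: split)
  \<comment> \<open>The certificate at 0 from the first term and the one at \<open>N\<close> from
    the last term cancel the two ends of the telescoped sum.\<close>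
  also have "\<dots> = vwp_term q y N 0 + (\<Sum>r<N. vwp_term q y N (Suc r))"
    using vwp_term_first[OF q, of N y] y
    by (simp add: step sum.distrib sum_lessThan_telescope vwp_term_last[OF q])
  also have "\<dots> = (\<Sum>t\<le>N. vwp_term q y N t)"
    by (simp add: split)
  also have "\<dots> = 1" using y by (intro Suc.IH) simp
  finally show ?case .
qed

section \<open>The exchange matrix\<close>

lemma qpow_choose_two:
  assumes "0 < q"
  shows "of_real q ^ (n choose 2) = qpow q (of_nat n * (of_nat n - 1) / 2)"
proof -
  have "(of_nat (n choose 2) :: complex) = of_nat n * (of_nat n - 1) / 2"
    by (induction n) (simp_all add: choose_two_Suc field_simps numeral_2_eq_2)
  then show ?thesis using qpow_of_nat[OF assms, of "n choose 2"] by (simp only:)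
qed

section \<open>The product form of the matrix \<open>L\<close>\<close>

definition twisted_R_coeff :: "real \<Rightarrow> complex \<Rightarrow> complex \<Rightarrow> complex \<Rightarrow> nat \<Rightarrow> nat \<Rightarrow> nat \<Rightarrow> complex" where
  "twisted_R_coeff q lam \<gamma> \<delta> s m k = R_coeff q \<delta> \<gamma> (s - k) k (m - k) /
    qpoch (qpow q (\<delta> - lam - 2 * of_nat s + of_nat m + of_nat k - 1)) q (m - k)"

text \<open>Every term of an entry of J L is the desired entry of P R P times a summand of the
  very-well-poised sum. The coefficients of e^t and e^u merge into that of e^(t+u), which does not
  depend on how \<open>t + u\<close> is split.\<close>

lemma fusion_coeff_mult_twisted_R_coeff:
  assumes q: "0 < q" "q < 1" and s: "k + t + u \<le> s"
  shows "fusion_coeff q lam \<gamma> \<delta> (k + t) (s - (k + t)) u * twisted_R_coeff q lam \<gamma> \<delta> s (k + t) k =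
    R_coeff q \<delta> \<gamma> (s - k) k (t + u) *
    vwp_term q (qpow q (\<delta> - lam - 2 * of_nat s + 2 * of_nat k)) (t + u) t"
proof -
  define c where "c = complex_of_real q"
  define y where "y = qpow q (\<delta> - lam - 2 * of_nat s + 2 * of_nat k)"
  define D1 D2 where "D1 = qpoch (y * c ^ (2 * t)) q u" and "D2 = qpoch (y * c ^ (t - 1)) q t"
  define er :: "nat \<Rightarrow> complex" where "er l = of_nat l * (wt \<delta> (s - k - l) - wt \<gamma> (k + l)) / 4 +
      wt \<delta> (s - k - l) * wt \<gamma> (k + l) / 4 - of_nat l" for l
  define ef :: complex where "ef = of_nat u * (- lam - 1 + (wt \<gamma> (k + t) + wt \<delta> (s - (k + t))) / 2 -
      (1 + lam - wt \<delta> (s - (k + t))) + (of_nat u - 1)) / 2"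
  have y: "qpow q (of_nat u * (\<delta> - lam - 2 * of_nat s + 2 * of_nat k)) = y ^ u"
    by (simp add: y_def qpow_power)
  have P: "qpoch c q j \<noteq> 0" for j unfolding c_def using q by (rule qpoch_q_nonzero)
  have "qpow q (wt \<delta> (s - (k + t)) - lam) = y * c ^ (2 * t)"
    unfolding y_def c_def qpow_of_nat[OF q(1), symmetric] qpow_add[symmetric] using s
    by (simp add: wt_def of_nat_diff algebra_simps)
  then have 1: "fusion_coeff q lam \<gamma> \<delta> (k + t) (s - (k + t)) u =
      qpow q ef * (1 - c) ^ (2 * u) * e_coeff q \<delta> (s - (k + t)) u / (qpoch c q u * D1)"
    unfolding fusion_coeff_eq[OF q] ef_def by (simp add: D1_def flip: c_def)
  have R: "R_coeff q \<delta> \<gamma> (s - k) k l = (- 1) ^ l * qpow q (er l) * (1 - c) ^ (2 * l) *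
      e_coeff q \<delta> (s - k) l / qpoch c q l" for l
    unfolding R_coeff_eq[OF q] er_def c_def ..
  have "qpoch (qpow q (\<delta> - lam - 2 * of_nat s + of_nat (k + t) + of_nat k - 1)) q t = D2"
  \<comment> \<open>For \<open>t = 0\<close> both products are empty; otherwise \<open>t - 1\<close>
    is a genuine predecessor.\<close>
  proof (cases t)
    case (Suc r)
    then show ?thesis
      unfolding D2_def y_def c_def qpow_of_nat[OF q(1), symmetric] qpow_add[symmetric]
      by (simp add: algebra_simps)
  qed (simp add: D2_def)
  then have 2: "twisted_R_coeff q lam \<gamma> \<delta> s (k + t) k = (- 1) ^ t * qpow q (er t) * (1 - c) ^ (2 * t) *
      e_coeff q \<delta> (s - k) t / qpoch c q t / D2"
    by (simp add: twisted_R_coeff_def R)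
  \<comment> \<open>The exponents differ from that of the target entry exactly by the powers of
    \<open>y\<close> and q in \<open>vwp_term\<close>.\<close>
  have "qpow q ef * qpow q (er t) = qpow q (er (t + u)) * qpow q (of_nat u * (\<delta> - lam - 2 * of_nat s + 2 * of_nat k)) *
      qpow q (of_nat (t + u) * (of_nat (t + u) - 1) / 2) / qpow q (of_nat t * (of_nat t - 1) / 2)"
    unfolding qpow_add[symmetric] qpow_diff[symmetric] ef_def er_def using s
    by (intro arg_cong[of _ _ "qpow q"]) (simp add: wt_def of_nat_diff field_simps)
  then have pow: "qpow q ef * qpow q (er t) =
      qpow q (er (t + u)) * (y ^ u * c ^ ((t + u) choose 2) / c ^ (t choose 2))"
    unfolding y c_def qpow_choose_two[OF q(1)] by (simp add: mult.assoc)
  have e: "e_coeff q \<delta> (s - k) (t + u) = e_coeff q \<delta> (s - k) t * e_coeff q \<delta> (s - (k + t)) u"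
    using e_coeff_mult[of t "s - k" q \<delta> u] s by simp
  have sign: "(- 1 :: complex) ^ (t + u) * (- 1) ^ (t + u + t) = (- 1) ^ t"
    by (simp add: power_add[symmetric] minus_one_power_iff)
  have O: "vwp_term q y (t + u) t = (- 1) ^ (t + u + t) * (y ^ u * c ^ ((t + u) choose 2) / c ^ (t choose 2)) *
      (qpoch c q (t + u) / (qpoch c q t * qpoch c q u)) / (D1 * D2)"
    by (simp add: vwp_term_def D1_def D2_def flip: c_def)
  have gen: "ef * wu * e1 / (cu * D1) * (st * ert * wt * e2 / ct / D2) =
      stu * er * (wt * wu) * (e2 * e1) / ctu * (stut * Y * (ctu / (ct * cu)) / (D1 * D2))"
    if "ef * ert = er * Y" "stu * stut = st" "ctu \<noteq> 0"
    for ef wu e1 cu D1 st ert wt e2 ct D2 stu er ctu stut Y :: complex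
  proof -
    have "ef * wu * e1 / (cu * D1) * (st * ert * wt * e2 / ct / D2) =
        (ef * ert) * st * wt * wu * e1 * e2 / (cu * D1 * ct * D2)"
      by (simp add: mult_ac)
    then show ?thesis using that(3)
      unfolding that(1) that(2)[symmetric] by (simp add: mult_ac)
  qed
  have "(1 - c) ^ (2 * (t + u)) = (1 - c) ^ (2 * t) * (1 - c) ^ (2 * u)"
    by (simp add: power_add algebra_simps)
  then show ?thesis
    unfolding y_def[symmetric] 1 2 R O e
    by (simp only:) (rule gen[OF pow sign P])
qed

lemma sum_fusion_coeff_mult_twisted_R_coeff:
  assumes q: "0 < q" "q < 1" and km: "k \<le> m" "m \<le> s"
    and nz: "\<And>j. 2 \<le> j \<Longrightarrow> j \<le> 2 * s \<Longrightarrow> qpow q (\<delta> - lam - of_nat j) \<noteq> 1"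
  shows "(\<Sum>i\<in>{k..m}. fusion_coeff q lam \<gamma> \<delta> i (s - i) (m - i) * twisted_R_coeff q lam \<gamma> \<delta> s i k) =
    R_coeff q \<delta> \<gamma> (s - k) k (m - k)"
proof -
  let ?y = "qpow q (\<delta> - lam - 2 * of_nat s + 2 * of_nat k)"
  \<comment> \<open>The exponent is \<delta> - lam - i with i = 2s - 2k - j, and 2 \<le> i \<le> 2s
    because m \<le> s.\<close>
  have "?y * of_real q ^ j \<noteq> 1" if "j + 2 \<le> 2 * (m - k)" for j
  proof -
    have "j + 2 * k \<le> 2 * s" using that km by simp
    then have "?y * of_real q ^ j = qpow q (\<delta> - lam - of_nat (2 * s - (j + 2 * k)))"
      unfolding qpow_of_nat[OF q(1), symmetric] qpow_add[symmetric]
      by (simp add: of_nat_diff algebra_simps)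
    then show ?thesis using nz[of "2 * s - (j + 2 * k)"] that km by simp
  qed
  then have 1: "(\<Sum>t\<le>m - k. vwp_term q ?y (m - k) t) = 1"
    by (rule sum_vwp_term[OF q])
  have "(\<Sum>i\<in>{k..m}. fusion_coeff q lam \<gamma> \<delta> i (s - i) (m - i) * twisted_R_coeff q lam \<gamma> \<delta> s i k) =
    (\<Sum>t\<le>m - k. fusion_coeff q lam \<gamma> \<delta> (k + t) (s - (k + t)) (m - k - t) * twisted_R_coeff q lam \<gamma> \<delta> s (k + t) k)"
    using km by (intro sum.reindex_bij_witness[of _ "\<lambda>t. k + t" "\<lambda>i. i - k"]) auto
  also have "\<dots> = (\<Sum>t\<le>m - k. R_coeff q \<delta> \<gamma> (s - k) k (m - k) * vwp_term q ?y (m - k) t)"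
  proof (rule sum.cong[OF refl])
    fix t assume "t \<in> {..m - k}"
    then show "fusion_coeff q lam \<gamma> \<delta> (k + t) (s - (k + t)) (m - k - t) * twisted_R_coeff q lam \<gamma> \<delta> s (k + t) k =
      R_coeff q \<delta> \<gamma> (s - k) k (m - k) * vwp_term q ?y (m - k) t"
      using fusion_coeff_mult_twisted_R_coeff[OF q, of k t "m - k - t" s lam \<gamma> \<delta>] km by simp
  qed
  also have "\<dots> = R_coeff q \<delta> \<gamma> (s - k) k (m - k)"
    unfolding sum_distrib_left[symmetric] 1 by simp
  finally show ?thesis .
qed

lemma qpow_neg_nat_eq_iff:
  assumes "0 < q" "q < 1"
  shows "qpow q (- of_nat i) = qpow q (- of_nat j) \<longleftrightarrow> i = j"
proof -
  have "qpow q (- of_nat i) = qpow q (- of_nat j) \<longleftrightarrow> q ^ i = q ^ j"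
    using assms by (simp add: qpow_minus qpow_of_nat flip: of_real_power)
  also have "\<dots> \<longleftrightarrow> i = j"
    using assms by (metis linorder_neqE_nat order_less_irrefl power_strict_decreasing)
  finally show ?thesis .
qed

lemma qpow_eq_neg_nat_iff: "qpow q x = qpow q (- of_nat r) \<longleftrightarrow> qpow q (x + of_nat r) = 1"
  by (simp add: qpow_add qpow_minus field_simps)

lemma qrising_eq_0_iff:
  assumes "0 < q" "q < 1"
  shows "qrising q a l = 0 \<longleftrightarrow> (\<exists>i<l. qpow q (a + of_nat i) = 1)"
  using assms of_real_power_neq_1[OF assms, of 1]
  by (auto simp: qrising_def qnum_eq)

text \<open>The longest denominator, \<open>l = k\<close>, contains the factors with exponents \<nu>
  - lam - 2k + i for i < k; put i = 2k - j.\<close>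

lemma fusion_definedD:
  assumes "0 < q" "q < 1" "fusion_defined q lam \<nu> k" "k < j" "j \<le> 2 * k"
  shows "qpow q (\<nu> - lam - of_nat j) \<noteq> 1"
proof -
  have "qrising q (- lam + wt \<nu> k) k \<noteq> 0"
    using assms(3) by (simp add: fusion_defined_def)
  moreover have "- lam + wt \<nu> k + of_nat (2 * k - j) = \<nu> - lam - of_nat j"
    using assms(4,5) by (simp add: wt_def of_nat_diff)
  moreover have "2 * k - j < k" using assms(4,5) by simp
  ultimately show ?thesis
    using qrising_eq_0_iff[OF assms(1,2)] by metis
qed

text \<open>Factorials of length n - k and m - k are the tails of those of length n and m in the
  prefactor. The heads of length \<open>k\<close> form the series term, and the hypotheses allow
  cancelling them.\<close>

lemma twisted_R_coeff_mult_fusion_coeff: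
  assumes q: "0 < q" "q < 1" and k: "k \<le> m" "k \<le> n" and s: "m \<le> s" "n \<le> s"
    and G0: "qpoch (qpow q (- \<gamma>)) q k \<noteq> 0"
    and D0: "qpoch (qpow q (\<delta> - of_nat s + 1)) q k \<noteq> 0"
    and L0: "qpoch (qpow q (lam - \<gamma> + of_nat n + 1)) q k \<noteq> 0"
    and B0: "qpoch (qpow q (\<delta> - lam - 2 * of_nat s + of_nat m - 1)) q k \<noteq> 0"
  shows "twisted_R_coeff q lam \<gamma> \<delta> s m k * fusion_coeff q lam \<delta> \<gamma> (s - n) n (n - k) =
      qpow q (\<gamma> / 4 * (\<delta> - 2 * of_nat s))
    * qpow q (of_nat n / 4 * (2 * of_nat n + \<delta> + \<gamma> - 2 * of_nat s))
    * qpow q (of_nat m / 4 * (- 3 * \<delta> + \<gamma> + 6 * of_nat s - 2 * of_nat m))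
    * (qpoch (qpow q (- \<gamma>)) q n / qpoch (qpow q (lam - \<gamma> + of_nat n + 1)) q n)
    * (qpochs [qpow q (- of_nat s), qpow q (\<delta> - of_nat s + 1)] q m
       / qpochs [of_real q, qpow q (\<delta> - lam - 2 * of_nat s + of_nat m - 1)] q m)
    * qhyp_term
        [qpow q (- of_nat n), qpow q (- of_nat m),
         qpow q (lam - \<gamma> + of_nat n + 1), qpow q (- lam + \<delta> - 2 * of_nat s + of_nat m - 1)]
        [qpow q (- of_nat s), qpow q (- \<gamma>), qpow q (\<delta> - of_nat s + 1)] q (of_real q) k"
    (is "_ = ?Q1 * ?Q2 * ?Q3 * _ * _ * _")
proof -
  define a b where "a = n - k" and "b = m - k"
  define c where "c = complex_of_real q"
  define N M S K :: complex where "N = of_nat n" and "M = of_nat m" and "S = of_nat s" and "K = of_nat k"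
  have ab: "of_nat a = N - K" "of_nat b = M - K" "n = k + a" "m = k + b"
    using k by (simp_all add: a_def b_def N_def M_def K_def of_nat_diff)
  have P: "qpoch c q j \<noteq> 0" for j unfolding c_def using q by (rule qpoch_q_nonzero)
  have c1: "1 - c \<noteq> 0" using of_real_power_neq_1[OF q, of 1] by (simp add: c_def)
  define G where "G = qpoch (qpow q (- \<gamma> + K)) q a"
  define D where "D = qpoch (qpow q (\<delta> - S + 1 + K)) q b"
  define L where "L = qpoch (qpow q (lam - \<gamma> + N + 1 + K)) q a"
  define B where "B = qpoch (qpow q (\<delta> - lam - 2 * S + M - 1 + K)) q b"
  have split: "qpoch (qpow q x) q (k + l) = qpoch (qpow q x) q k * qpoch (qpow q (x + K)) q l" for x l
    using q by (simp add: qpoch_add K_def qpow_add qpow_of_nat)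
  have wts: "wt \<delta> (s - k - b) = \<delta> - 2 * (S - M)" "wt \<gamma> (k + b) = \<gamma> - 2 * M"
      "wt \<delta> (s - n) = \<delta> - 2 * (S - N)" "wt \<gamma> n = \<gamma> - 2 * N"
    using s ab by (simp_all add: wt_def S_def M_def N_def of_nat_diff)
  \<comment> \<open>\<open>Er\<close> and \<open>Ef\<close> come from \<open>R_coeff_eq\<close> and
    \<open>fusion_coeff_eq\<close>, \<open>P1\<close> and \<open>P2\<close> from
    \<open>e_coeff_eq\<close>, \<open>Eg\<close> and \<open>El\<close> from
    \<open>qpoch_reflect\<close>, the others from \<open>qpoch_neg_nat\<close>.\<close>
  define Er P1 Ef P2 Eg El Em Ek1 Ek2 Ek3 where
    "Er = qpow q ((M - K) * (\<delta> - 2 * (S - M) - (\<gamma> - 2 * M)) / 4 + (\<delta> - 2 * (S - M)) * (\<gamma> - 2 * M) / 4 - (M - K))"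
    and "P1 = qpow q ((M - K) * (1 - \<delta>) / 2)"
    and "Ef = qpow q ((N - K) * (- lam - 1 + (\<delta> - 2 * (S - N) + (\<gamma> - 2 * N)) / 2 - (1 + lam - (\<gamma> - 2 * N)) + (N - K - 1)) / 2)"
    and "P2 = qpow q ((N - K) * (1 - \<gamma>) / 2)"
    and "Eg = qpow q ((N - K) * (\<gamma> - N + 1) + (N - K) * (N - K - 1) / 2)"
    and "El = qpow q ((N - K) * (\<gamma> - 2 * N - lam) + (N - K) * (N - K - 1) / 2)"
    and "Em = qpow q (M * (M - 1) / 2 - S * M)"
    and "Ek1 = qpow q (K * (K - 1) / 2 - N * K)"
    and "Ek2 = qpow q (K * (K - 1) / 2 - M * K)"
    and "Ek3 = qpow q (K * (K - 1) / 2 - S * K)"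
  note E_defs = this
  have "Er * P1 * Ef * P2 * Eg / El = ?Q1 * ?Q2 * ?Q3 * Em * Ek1 * Ek2 / Ek3 * qpow q K"
    unfolding E_defs qpow_add[symmetric] qpow_diff[symmetric] N_def[symmetric] M_def[symmetric] S_def[symmetric]
    by (intro arg_cong[of _ _ "qpow q"]) (simp add: field_simps)
  then have pow: "Er * P1 * Ef * P2 * Eg / El = ?Q1 * ?Q2 * ?Q3 * Em * Ek1 * Ek2 / Ek3 * c ^ k"
    using q by (simp add: K_def qpow_of_nat c_def)
  have E_nz: "El \<noteq> 0" "Ek3 \<noteq> 0" by (simp_all add: E_defs)
  have T1: "twisted_R_coeff q lam \<gamma> \<delta> s m k = (- 1) ^ b * Er * (1 - c) ^ (2 * b) *
      (P1 * (qpoch c q (s - k) / qpoch c q (s - m)) * D / (1 - c) ^ (2 * b)) / qpoch c q b / B"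
  proof -
    have "qpow q (\<delta> - of_nat (s - k) + 1) = qpow q (\<delta> - S + 1 + K)"
      using s k by (simp add: S_def K_def of_nat_diff algebra_simps)
    then have "e_coeff q \<delta> (s - k) b = P1 * (qpoch c q (s - k) / qpoch c q (s - m)) * D / (1 - c) ^ (2 * b)"
      using s k by (subst e_coeff_eq[OF q]) (auto simp: b_def D_def E_defs c_def ab(2)[unfolded b_def])
    moreover have "qpow q (\<delta> - lam - 2 * of_nat s + of_nat m + of_nat k - 1) = qpow q (\<delta> - lam - 2 * S + M - 1 + K)"
      by (simp add: S_def M_def K_def algebra_simps)
    ultimately show ?thesis
      unfolding twisted_R_coeff_def b_def[symmetric] R_coeff_eq[OF q] wts ab(2) B_def Er_def c_def[symmetric]
      by (simp only:)
  qed
  have T2: "fusion_coeff q lam \<delta> \<gamma> (s - n) n a = Ef * (1 - c) ^ (2 * a) *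
      (P2 * (qpoch c q n / qpoch c q k) * ((- 1) ^ a * Eg * G) / (1 - c) ^ (2 * a)) /
      (qpoch c q a * ((- 1) ^ a * El * L))"
  proof -
    \<comment> \<open>Reflection brings both factorials to the tails \<open>G\<close> and
      \<open>L\<close>; its signs cancel in the quotient.\<close>
    have *: "1 - (\<gamma> - N + 1) - (N - K) = - \<gamma> + K" "1 - (\<gamma> - 2 * N - lam) - (N - K) = lam - \<gamma> + N + 1 + K"
      by simp_all
    have "qpoch (qpow q (\<gamma> - N + 1)) q a = (- 1) ^ a * Eg * G"
      and "qpoch (qpow q (\<gamma> - 2 * N - lam)) q a = (- 1) ^ a * El * L"
      using qpoch_reflect[OF q(1), of "\<gamma> - N + 1" a] qpoch_reflect[OF q(1), of "\<gamma> - 2 * N - lam" a]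
      unfolding ab(1) * by (simp_all only: E_defs G_def L_def)
    moreover have "a \<le> n" "n - a = k" using k by (simp_all add: a_def)
    ultimately show ?thesis
      unfolding fusion_coeff_eq[OF q] wts ab(1) e_coeff_eq[OF q \<open>a \<le> n\<close>] N_def[symmetric] Ef_def P2_def c_def[symmetric]
      by (simp only:)
  qed
  have neg: "qpoch (qpow q (- S)) q m = (- 1) ^ m * Em * qpoch c q s / qpoch c q (s - m)"
    "qpoch (qpow q (- N)) q k = (- 1) ^ k * Ek1 * qpoch c q n / qpoch c q a"
    "qpoch (qpow q (- M)) q k = (- 1) ^ k * Ek2 * qpoch c q m / qpoch c q b"
    "qpoch (qpow q (- S)) q k = (- 1) ^ k * Ek3 * qpoch c q s / qpoch c q (s - k)"
    using k s
    by (simp_all add: S_def N_def M_def K_def E_defs a_def b_def c_def qpoch_neg_nat[OF q])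
  \<comment> \<open>On the series side (-1)^m comes from (q^(-s);q)_m, and of three factors (-1)^k,
    two above and one below, one survives.\<close>
  have sign: "(- 1 :: complex) ^ b = (- 1) ^ m * (- 1) ^ k"
    by (simp add: ab(4) power_add mult_ac flip: power_mult_distrib)
  have gen: "sb * er * w * (p1 * (cS / cP) * D / w) / cb / B * (ef * v * (p2 * (cn / ck) * (sa * eg * G) / v) / (ca * (sa * el * L)))
     = q1 * q2 * q3 * ((G0 * G) / (L0 * L)) * ((sm * em * cs / cP) * (D0 * D * 1) / (cm * (B0 * B * 1))) *
       ((sk * e1 * cn / ca) * ((sk * e2 * cm / cb) * (L0 * (B0 * 1))) / ((sk * e3 * cs / cS) * (G0 * (D0 * (ck * 1)))) * z)"
    if "er * p1 * ef * p2 * eg / el = q1 * q2 * q3 * em * e1 * e2 / e3 * z" "sb = sm * sk"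
      "w \<noteq> 0" "v \<noteq> 0" "sa \<noteq> 0" "sk \<noteq> 0" "cs \<noteq> 0" "cS \<noteq> 0" "cm \<noteq> 0"
      "G0 \<noteq> 0" "D0 \<noteq> 0" "L0 \<noteq> 0" "B0 \<noteq> 0"
    for sb er w p1 cS cP D cb B ef v p2 cn ck sa eg G ca el L q1 q2 q3 G0 L0 sm em cs D0 cm B0 sk e1 e2 e3 z :: complex
  proof -
    have "sb * er * w * (p1 * (cS / cP) * D / w) / cb / B * (ef * v * (p2 * (cn / ck) * (sa * eg * G) / v) / (ca * (sa * el * L)))
      = (er * p1 * ef * p2 * eg / el) * sb * (cS / cP) * D / cb / B * (cn / ck) * G / (ca * L)"
      using that(3-) by (simp add: mult_ac)
    also have "\<dots> = q1 * q2 * q3 * ((G0 * G) / (L0 * L)) * ((sm * em * cs / cP) * (D0 * D * 1) / (cm * (B0 * B * 1))) *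
       ((sk * e1 * cn / ca) * ((sk * e2 * cm / cb) * (L0 * (B0 * 1))) / ((sk * e3 * cs / cS) * (G0 * (D0 * (ck * 1)))) * z)"
      unfolding that(1,2) using that(3-) by (simp add: mult_ac)
    finally show ?thesis .
  qed
  have 4: "- lam + \<delta> - 2 * S + M - 1 = \<delta> - lam - 2 * S + M - 1" by simp
  have splits:
    "qpoch (qpow q (- \<gamma>)) q n = qpoch (qpow q (- \<gamma>)) q k * G"
    "qpoch (qpow q (lam - \<gamma> + N + 1)) q n = qpoch (qpow q (lam - \<gamma> + N + 1)) q k * L"
    "qpoch (qpow q (\<delta> - S + 1)) q m = qpoch (qpow q (\<delta> - S + 1)) q k * D"
    "qpoch (qpow q (\<delta> - lam - 2 * S + M - 1)) q m = qpoch (qpow q (\<delta> - lam - 2 * S + M - 1)) q k * B"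
    unfolding G_def L_def D_def B_def by (simp_all only: split[symmetric] ab(3,4))
  have w: "(1 - c) ^ (2 * j) \<noteq> 0" "(- 1 :: complex) ^ j \<noteq> 0" for j using c1 by simp_all
  note [unfolded S_def[symmetric] N_def[symmetric] M_def[symmetric]] = G0 D0 L0 B0
  note nz = this
  show ?thesis
    unfolding a_def[symmetric] T1 T2 qhyp_term_def qpochs_def list.map append.simps prod_list.Cons prod_list.Nil
      S_def[symmetric] N_def[symmetric] M_def[symmetric] c_def[symmetric] 4 neg splits
    by (rule gen[OF pow[folded N_def M_def S_def] sign w(1) w(1) w(2) w(2) P P P nz])
qed

section \<open>Identification with the q-Racah polynomial\<close>

lemma q_racah_eq_qhyp:
  assumes "0 < q"
  shows "q_racah q m n (qpow q (\<delta> - of_nat s)) (qpow q (- lam - of_nat s - 2))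
        (qpow q (- of_nat s - 1)) (qpow q (lam - \<gamma> + of_nat s + 1))
     = qhyp
          [qpow q (- of_nat n), qpow q (- of_nat m),
           qpow q (lam - \<gamma> + of_nat n + 1), qpow q (- lam + \<delta> - 2 * of_nat s + of_nat m - 1)]
          [qpow q (- of_nat s), qpow q (- \<gamma>), qpow q (\<delta> - of_nat s + 1)] q (of_real q)"
proof -
  have "qpow q (- of_nat s - 1) * qpow q (lam - \<gamma> + of_nat s + 1) * of_real q ^ (n + 1) =
      qpow q (lam - \<gamma> + of_nat n + 1)"
    and "qpow q (\<delta> - of_nat s) * qpow q (- lam - of_nat s - 2) * of_real q ^ (m + 1) =
      qpow q (- lam + \<delta> - 2 * of_nat s + of_nat m - 1)"
    and "qpow q (- of_nat s - 1) * of_real q = qpow q (- of_nat s)"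
    and "qpow q (- lam - of_nat s - 2) * qpow q (lam - \<gamma> + of_nat s + 1) * of_real q = qpow q (- \<gamma>)"
    and "qpow q (\<delta> - of_nat s) * of_real q = qpow q (\<delta> - of_nat s + 1)"
    unfolding qpow_1[OF assms, symmetric] qpow_power qpow_add[symmetric]
    by - (rule arg_cong[of _ _ "qpow q"], simp add: algebra_simps)+
  then show ?thesis unfolding q_racah_def by (simp only:)
qed

theorem theorem9p2:
  fixes q :: real and m n s :: nat and lam \<gamma> \<delta> :: complex
  assumes q: "0 < q" "q < 1"
    and mns: "m \<le> s" "n \<le> s"
    and par: "lam - \<gamma> \<notin> \<nat>" "lam - \<delta> \<notin> \<nat>" "lam - \<delta> - \<gamma> \<notin> \<nat>"
    and fusion_WV_defined: "fusion_defined q lam \<gamma> n"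
    and fusion_VW_defined: "\<forall>k\<le>s. fusion_defined q lam \<delta> k"
    and racah_allowed: "qhyp_allowed
          [qpow q (- of_nat n), qpow q (- of_nat m),
           qpow q (lam - \<gamma> + of_nat n + 1), qpow q (- lam + \<delta> - 2 * of_nat s + of_nat m - 1)]
          [qpow q (- of_nat s), qpow q (- \<gamma>), qpow q (\<delta> - of_nat s + 1)] q"
  shows "exchange_elem q \<gamma> \<delta> s m n lam =
      qpow q (\<gamma> / 4 * (\<delta> - 2 * of_nat s))
    * qpow q (of_nat n / 4 * (2 * of_nat n + \<delta> + \<gamma> - 2 * of_nat s))
    * qpow q (of_nat m / 4 * (- 3 * \<delta> + \<gamma> + 6 * of_nat s - 2 * of_nat m))
    * (qpoch (qpow q (- \<gamma>)) q n / qpoch (qpow q (lam - \<gamma> + of_nat n + 1)) q n)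
    * (qpochs [qpow q (- of_nat s), qpow q (\<delta> - of_nat s + 1)] q m
       / qpochs [of_real q, qpow q (\<delta> - lam - 2 * of_nat s + of_nat m - 1)] q m)
    * q_racah q m n (qpow q (\<delta> - of_nat s)) (qpow q (- lam - of_nat s - 2))
        (qpow q (- of_nat s - 1)) (qpow q (lam - \<gamma> + of_nat s + 1))
   \<and> q_racah q m n (qpow q (\<delta> - of_nat s)) (qpow q (- lam - of_nat s - 2))
        (qpow q (- of_nat s - 1)) (qpow q (lam - \<gamma> + of_nat s + 1))
     = qhyp
          [qpow q (- of_nat n), qpow q (- of_nat m),
           qpow q (lam - \<gamma> + of_nat n + 1), qpow q (- lam + \<delta> - 2 * of_nat s + of_nat m - 1)]
          [qpow q (- of_nat s), qpow q (- \<gamma>), qpow q (\<delta> - of_nat s + 1)] q (of_real q)"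
proof
  let ?as = "[qpow q (- of_nat n), qpow q (- of_nat m),
           qpow q (lam - \<gamma> + of_nat n + 1), qpow q (- lam + \<delta> - 2 * of_nat s + of_nat m - 1)]"
  let ?bs = "[qpow q (- of_nat s), qpow q (- \<gamma>), qpow q (\<delta> - of_nat s + 1)]"
  have W: "qpow q (lam - \<gamma> + of_nat n + 1 + of_nat r) \<noteq> 1" if "r < n" for r
  proof -
    have "qpow q (\<gamma> - lam - of_nat (n + 1 + r)) \<noteq> 1"
      using that by (intro fusion_definedD[OF q fusion_WV_defined]) auto
    moreover have "\<gamma> - lam - of_nat (n + 1 + r) = - (lam - \<gamma> + of_nat n + 1 + of_nat r)"
      by simp
    ultimately show ?thesis by (metis inverse_1 qpow_minus)
  qed
  \<comment> \<open>With k = (j + 1) div 2 one has k < j \<le> 2k and k \<le> s, the first because 2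
    \<le> j.\<close>
  have V: "qpow q (\<delta> - lam - of_nat j) \<noteq> 1" if "2 \<le> j" "j \<le> 2 * s" for j
    using that fusion_VW_defined
    by (intro fusion_definedD[OF q, of _ _ "(j + 1) div 2"]) auto
  have V': "qpow q (\<delta> - lam - 2 * of_nat s + of_nat m - 1 + of_nat r) \<noteq> 1" if "r < m" for r
  proof -
    have "\<delta> - lam - of_nat (2 * s + 1 - (m + r)) = \<delta> - lam - 2 * of_nat s + of_nat m - 1 + of_nat r"
      using that mns by (subst of_nat_diff) auto
    moreover have "2 \<le> 2 * s + 1 - (m + r)" "2 * s + 1 - (m + r) \<le> 2 * s"
      using that mns by auto
    note V[OF this]
    ultimately show ?thesis by (simp only: not_False_eq_True)
  qed
  \<comment> \<open>By \<open>W\<close> and \<open>V'\<close> the two parameters involving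
    \<open>lam\<close> do not end the series before \<open>min m n\<close>, so its cut-off is the
    range of the triangular sum.\<close>
  have no_stop: "\<not> qhyp_stops ?as q r" if "r < min m n" for r
  proof -
    have r: "r < n" "r < m" "r \<noteq> n" "r \<noteq> m" using that by auto
    have "- lam + \<delta> - 2 * of_nat s + of_nat m - 1 = \<delta> - lam - 2 * of_nat s + of_nat m - 1"
      by simp
    then have "qpow q (- lam + \<delta> - 2 * of_nat s + of_nat m - 1) \<noteq> qpow q (- of_nat r)"
      unfolding qpow_eq_neg_nat_iff by (simp only: V'[OF r(2)] not_False_eq_True)
    moreover have "qpow q (lam - \<gamma> + of_nat n + 1) \<noteq> qpow q (- of_nat r)"
      unfolding qpow_eq_neg_nat_iff by (rule W[OF r(1)])
    moreover have "qpow q (- of_nat n) \<noteq> qpow q (- of_nat r)" "qpow q (- of_nat m) \<noteq> qpow q (- of_nat r)"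
      using r(3,4) unfolding qpow_neg_nat_eq_iff[OF q] by blast+
    ultimately show ?thesis
      unfolding qhyp_stops_def by (simp only: list.set bex_simps insert_iff empty_iff) blast
  qed
  have "qhyp_stops ?as q m" "qhyp_stops ?as q n"
    unfolding qhyp_stops_def by (simp_all only: list.set bex_simps simp_thms)
  then have stop: "qhyp_stops ?as q (min m n)"
    unfolding min_def by (simp only: if_split simp_thms)
  have least: "(LEAST r. qhyp_stops ?as q r) = min m n"
    by (rule Least_equality, rule stop) (metis no_stop not_le)
  \<comment> \<open>A zero factor would make a lower parameter q^(-p) with p <
    \<open>min m n\<close>; admissibility then yields a stop at some r \<le> p, against
    \<open>no_stop\<close>.\<close>
  have lower: "qpoch b q k \<noteq> 0" if "b \<in> set ?bs" "k \<le> min m n" for b k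
  proof
    assume "qpoch b q k = 0"
    then obtain p where p: "p < k" "b * of_real q ^ p = 1"
      by (auto simp: qpoch_eq_0_iff)
    have "b = qpow q (- of_nat p)"
      unfolding qpow_minus qpow_of_nat[OF q(1)]
      by (rule inverse_unique[symmetric]) (simp only: p(2) mult.commute[of _ b])
    from racah_allowed[unfolded qhyp_allowed_def, rule_format, OF that(1) this]
    obtain r where r: "r \<le> p" "qhyp_stops ?as q r" by (elim exE conjE)
    have "r < min m n" using r(1) p(1) that(2) by linarith
    then show False using no_stop r(2) by blast
  qed
  have nz: "qpoch (qpow q (lam - \<gamma> + of_nat n + 1)) q k \<noteq> 0"
    "qpoch (qpow q (\<delta> - lam - 2 * of_nat s + of_nat m - 1)) q k \<noteq> 0" if "k \<le> min m n" for k
  proof -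
    have "i < n" "i < m" if "i < k" for i using that \<open>k \<le> min m n\<close> by simp_all
    then show "qpoch (qpow q (lam - \<gamma> + of_nat n + 1)) q k \<noteq> 0"
      "qpoch (qpow q (\<delta> - lam - 2 * of_nat s + of_nat m - 1)) q k \<noteq> 0"
      unfolding qpoch_eq_0_iff qpow_of_nat[OF q(1), symmetric] qpow_add[symmetric] using W V' by blast+
  qed
  let ?pre = "qpow q (\<gamma> / 4 * (\<delta> - 2 * of_nat s))
    * qpow q (of_nat n / 4 * (2 * of_nat n + \<delta> + \<gamma> - 2 * of_nat s))
    * qpow q (of_nat m / 4 * (- 3 * \<delta> + \<gamma> + 6 * of_nat s - 2 * of_nat m))
    * (qpoch (qpow q (- \<gamma>)) q n / qpoch (qpow q (lam - \<gamma> + of_nat n + 1)) q n)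
    * (qpochs [qpow q (- of_nat s), qpow q (\<delta> - of_nat s + 1)] q m
       / qpochs [of_real q, qpow q (\<delta> - lam - 2 * of_nat s + of_nat m - 1)] q m)"
  have "exchange_elem q \<gamma> \<delta> s m n lam =
      (\<Sum>k\<le>min m n. twisted_R_coeff q lam \<gamma> \<delta> s m k * fusion_coeff q lam \<delta> \<gamma> (s - n) n (n - k))"
    by (rule exchange_elem_eq_sum[OF mns], rule sum_fusion_coeff_mult_twisted_R_coeff[OF q _ _ V])
  also have "\<dots> = (\<Sum>k\<le>min m n. ?pre * qhyp_term ?as ?bs q (of_real q) k)"
  proof (rule sum.cong[OF refl])
    fix k assume "k \<in> {..min m n}"
    then have k: "k \<le> min m n" "k \<le> m" "k \<le> n" by simp_all
    show "twisted_R_coeff q lam \<gamma> \<delta> s m k * fusion_coeff q lam \<delta> \<gamma> (s - n) n (n - k) =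
        ?pre * qhyp_term ?as ?bs q (of_real q) k"
      by (rule twisted_R_coeff_mult_fusion_coeff[OF q k(2,3) mns lower[OF _ k(1)] lower[OF _ k(1)] nz[OF k(1)]])
        (simp_all only: list.set insert_iff simp_thms)
  qed
  also have "\<dots> = ?pre * qhyp ?as ?bs q (of_real q)"
    unfolding qhyp_def least sum_distrib_left[symmetric] if_P[OF exI[of "qhyp_stops ?as q", OF stop]] ..
  finally show "exchange_elem q \<gamma> \<delta> s m n lam = ?pre *
      q_racah q m n (qpow q (\<delta> - of_nat s)) (qpow q (- lam - of_nat s - 2))
        (qpow q (- of_nat s - 1)) (qpow q (lam - \<gamma> + of_nat s + 1))"
    unfolding q_racah_eq_qhyp[OF q(1)] .
qed (rule q_racah_eq_qhyp[OF q(1)])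

end
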